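(* Let $K>0$, $\theta,\theta_1,\theta_2\in\mathbb{R}$, $\gamma\in\mathbb{C}$, and set $$U=Ke^{i\theta_1}\Big(\frac12\varphi_0^\gamma+\frac{\sqrt3}{2}ie^{i\theta}\varphi_1^\gamma\Big),\qquad V=Ke^{i\theta_2}\Big(\frac12\varphi_0^\gamma-\frac{\sqrt3}{2}ie^{i\theta}\varphi_1^\gamma\Big).$$ Let $(u,v)$ be the solution to $$i\partial_t u=\Pi(|v|^2u),\qquad i\partial_t v=-\Pi(|u|^2v),\qquad u(0,\cdot)=U,\quad v(0,\cdot)=V.$$ Then for all $s\geq0$, $$\|\langle z\rangle^su(t)\|_{L^2(\mathbb{C})}\sim\alpha_0^sK^{2s+1}|t|^s,\qquad\|\langle z\rangle^sv(t)\|_{L^2(\mathbb{C})}\sim\alpha_0^sK^{2s+1}|t|^s,\qquad t\to\pm\infty,$$ with $\alpha_0=\frac{\sqrt3}{32\pi}$.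
   Context: $L$ is Lebesgue measure on $\mathbb{C}$, $\langle z\rangle=(1+|z|^2)^{1/2}$, and $f(t)\sim g(t)$ means that the ratio $f(t)/g(t)$ tends to $1$. The Bargmann-Fock space is $\mathcal{E}=\{u(z)=e^{-|z|^2/2}f(z):\ f \text{ entire holomorphic}\}\cap L^2(\mathbb{C})$. $\Pi$ is the orthogonal projection onto $\mathcal{E}$, given by $[\Pi u](z)=\frac1\pi e^{-|z|^2/2}\int_{\mathbb{C}}e^{\overline{w}z-|w|^2/2}u(w)\,dL(w)$. For $n\in\mathbb{N}$ and $\gamma\in\mathbb{C}$, $$\varphi_n^\gamma(z)=\frac{1}{\sqrt{\pi n!}}(z-\overline{\gamma})^ne^{-\frac{|z|^2}{2}-\frac{|\gamma|^2}{2}+\gamma z}.$$ For every initial datum in $\mathcal{E}\times\mathcal{E}$ the system has a unique solution in $\mathcal{C}^\infty(\mathbb{R},\mathcal{E}\times\mathcal{E})$. *)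

theory Defs
  imports "HOL-Analysis.Analysis" "HOL-Library.Landau_Symbols"
begin

text \<open>
  Elements of \<open>L\<^sup>2(\<complex>)\<close> are represented by genuine functions. No quotient by equality almost
  everywhere is needed: elements of the Bargmann-Fock space are continuous.
\<close>

definition square_integrable :: "(complex \<Rightarrow> complex) \<Rightarrow> bool" where
  "square_integrable u \<longleftrightarrow>
     u \<in> borel_measurable lborel \<and> integrable lborel (\<lambda>z. (cmod (u z))\<^sup>2)"

text \<open>
  The Bochner integral is 0 for a non-integrable integrand, so \<open>L2_norm u = 0\<close> when \<open>u\<close> is not
  square integrable. Hence \<open>L2_norm (w t) \<sim> g t\<close> with \<open>g t > 0\<close> still forces \<open>w t\<close> to have a
  finite norm for all large \<open>t\<close>.
\<close>

definition L2_norm :: "(complex \<Rightarrow> complex) \<Rightarrow> real" where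
  "L2_norm u = sqrt (\<integral>z. (cmod (u z))\<^sup>2 \<partial>lborel)"

definition bargmann_fock :: "(complex \<Rightarrow> complex) set" where
  "bargmann_fock =
     {u. (\<exists>f. f holomorphic_on UNIV \<and> u = (\<lambda>z. exp (- of_real ((cmod z)\<^sup>2 / 2)) * f z))
         \<and> square_integrable u}"

definition bf_proj :: "(complex \<Rightarrow> complex) \<Rightarrow> complex \<Rightarrow> complex" where
  "bf_proj u z =
     1 / of_real pi * exp (- of_real ((cmod z)\<^sup>2 / 2)) *
       (\<integral>w. exp (cnj w * z - of_real ((cmod w)\<^sup>2 / 2)) * u w \<partial>lborel)"

definition phi :: "nat \<Rightarrow> complex \<Rightarrow> complex \<Rightarrow> complex" where
  "phi n \<gamma> z =
     1 / of_real (sqrt (pi * fact n)) * (z - cnj \<gamma>) ^ n *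
       exp (- of_real ((cmod z)\<^sup>2 / 2) - of_real ((cmod \<gamma>)\<^sup>2 / 2) + \<gamma> * z)"

definition japanese_bracket :: "complex \<Rightarrow> real" where
  "japanese_bracket z = sqrt (1 + (cmod z)\<^sup>2)"

definition weighted_norm :: "real \<Rightarrow> (complex \<Rightarrow> complex) \<Rightarrow> real" where
  "weighted_norm s u = L2_norm (\<lambda>z. of_real (japanese_bracket z powr s) * u z)"

text \<open>
  Differentiability of a curve \<open>u :: real \<Rightarrow> (complex \<Rightarrow> complex)\<close> for the \<open>L\<^sup>2\<close> norm. It is only used
  when all values of \<open>u\<close> and the derivative \<open>w\<close> lie in the Bargmann-Fock space, so that the
  \<open>L2_norm\<close> below is the true norm.
\<close>

definition has_L2_derivative ::
  "(real \<Rightarrow> complex \<Rightarrow> complex) \<Rightarrow> (complex \<Rightarrow> complex) \<Rightarrow> real \<Rightarrow> bool" where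
  "has_L2_derivative u w t \<longleftrightarrow>
     ((\<lambda>h. L2_norm (\<lambda>z. (u (t + h) z - u t z) / of_real h - w z)) \<longlongrightarrow> 0) (at 0)"

text \<open>\<open>D k\<close> is the \<open>k\<close>-th time derivative of the curve \<open>u\<close>.\<close>

definition smooth_bf_curve :: "(real \<Rightarrow> complex \<Rightarrow> complex) \<Rightarrow> bool" where
  "smooth_bf_curve u \<longleftrightarrow>
     (\<exists>D :: nat \<Rightarrow> real \<Rightarrow> complex \<Rightarrow> complex. D 0 = u \<and>
        (\<forall>k t. D k t \<in> bargmann_fock \<and> has_L2_derivative (D k) (D (Suc k) t) t))"

text \<open>
  A pair of curves is smooth with values in the product space iff both components are smooth.
\<close>

definition is_solution ::
  "(real \<Rightarrow> complex \<Rightarrow> complex) \<Rightarrow> (real \<Rightarrow> complex \<Rightarrow> complex) \<Rightarrow>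
   (complex \<Rightarrow> complex) \<Rightarrow> (complex \<Rightarrow> complex) \<Rightarrow> bool" where
  "is_solution u v U V \<longleftrightarrow>
     smooth_bf_curve u \<and> smooth_bf_curve v \<and> u 0 = U \<and> v 0 = V \<and>
     (\<forall>t. \<exists>ut\<in>bargmann_fock. \<exists>vt\<in>bargmann_fock.
        has_L2_derivative u ut t \<and> has_L2_derivative v vt t \<and>
        (\<forall>z. \<i> * ut z = bf_proj (\<lambda>w. of_real ((cmod (v t w))\<^sup>2) * u t w) z) \<and>
        (\<forall>z. \<i> * vt z = - bf_proj (\<lambda>w. of_real ((cmod (u t w))\<^sup>2) * v t w) z))"

end

theory Submission
  imports Defs "HOL-Probability.Distributions" "HOL-Complex_Analysis.Complex_Analysis"
begin

text \<open>
  The solution is an explicit travelling wave, and the theorem reads off its speed.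

  Write \<open>E\<^sub>\<gamma>(z) = exp(-|z|\<^sup>2/2 - |\<gamma>|\<^sup>2/2 + \<gamma> z)\<close>; its modulus is a Gaussian centred at
  \<open>cnj \<gamma>\<close>. The functions \<open>(a + b (z - cnj \<gamma>)) E\<^sub>\<gamma>\<close> span the first two levels over the centre
  \<open>cnj \<gamma>\<close>, and \<open>U\<close>, \<open>V\<close> are of this form. For \<open>v = (c + d (z - cnj \<gamma>)) E\<^sub>\<gamma>\<close> the cubic term
  \<open>\<Pi>(|v|\<^sup>2 u)\<close> is \<open>E\<^sub>\<gamma>\<close> times a polynomial of degree 2 in \<open>z - cnj \<gamma>\<close> (lemma \<open>bf_proj_packet\<close>), whose
  top coefficient is \<open>b cnj(c) d / 8\<close>. On the other side, differentiating the same ansatz in time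
  with a moving centre \<open>\<gamma>(t)\<close> produces the degree 2 term \<open>b \<gamma>'(t)\<close>. Hence the term of degree 2
  can be absorbed by letting \<open>\<gamma>\<close> move with velocity \<open>\<delta> = - \<i> cnj(c) d / 8\<close>, and the equation for
  \<open>v\<close>, which has the opposite sign, asks for \<open>\<delta> = \<i> cnj(a) b / 8\<close>. Both hold at once because the
  second coefficients of \<open>U\<close> and \<open>V\<close> have opposite signs relative to the first ones. The two
  remaining coefficients then only rotate. The constraint that \<open>a\<close> and \<open>b\<close> rotate at the same rate, so
  that \<open>cnj(a) b\<close> stays constant, is \<open>|b|\<^sup>2 = 3 |a|\<^sup>2\<close>; this is where the weights \<open>1/2\<close> and \<open>\<surd>3/2\<close>
  come from. The result is \<open>wave_fock_flow\<close>.

  The hypothesis of the theorem concerns an arbitrary solution, so uniqueness is needed. Point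
  evaluations are bounded on the Bargmann-Fock space (\<open>bargmann_fock_pointwise_bound\<close>, from the mean
  value property) and \<open>\<Pi>\<close> is bounded on \<open>L\<^sup>2\<close> (\<open>bf_proj_L2_bound\<close>, a Schur test); together they make
  the cubic nonlinearity locally Lipschitz for the \<open>L\<^sup>2\<close> norm, and a Gronwall argument gives
  \<open>fock_flow_unique\<close>.

  Finally, translating by the centre turns the weighted norm of the wave into
  \<open>\<integral> \<langle>cnj(\<gamma>(t)) + w\<rangle>\<^bsup>2s\<^esup> |a + b w|\<^sup>2 exp(-|w|\<^sup>2) dw\<close>, where the profile no longer depends on time while
  \<open>|\<gamma>(t)|\<close> is asymptotic to \<open>|\<delta>| |t|\<close>. Dominated convergence yields \<open>(|\<delta>| |t|)\<^bsup>s\<^esup>\<close> times the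
  constant \<open>L\<^sup>2\<close> norm \<open>K\<close>, and \<open>|\<delta>| = \<alpha>\<^sub>0 K\<^sup>2\<close> (\<open>weighted_norm_wave_asymp\<close>).
\<close>

section \<open>Lebesgue measure on the complex plane\<close>

lemma measurable_cnj [measurable]: "cnj \<in> borel_measurable borel"
  by (intro borel_measurable_continuous_onI continuous_intros)

lemma measurable_Complex [measurable (raw)]:
  assumes [measurable]: "f \<in> borel_measurable M" "g \<in> borel_measurable M"
  shows "(\<lambda>x. Complex (f x) (g x)) \<in> borel_measurable M"
  unfolding Complex_eq by measurable

lemma lborel_complex:
  "(lborel :: complex measure) = distr (lborel \<Otimes>\<^sub>M lborel) borel (\<lambda>(x, y). Complex x y)"
proof (rule lborel_eqI)
  fix l u :: complex
  assume lu: "\<And>b. b \<in> Basis \<Longrightarrow> l \<bullet> b \<le> u \<bullet> b"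
  have le: "Re l \<le> Re u" "Im l \<le> Im u"
    using lu[of 1] lu[of \<i>] by (auto simp: Basis_complex_def)
  have vimg: "(\<lambda>(x, y). Complex x y) -` box l u \<inter> space (lborel \<Otimes>\<^sub>M lborel)
      = {Re l<..<Re u} \<times> {Im l<..<Im u}"
    by (auto simp: box_def Basis_complex_def space_pair_measure)
  have "emeasure (distr (lborel \<Otimes>\<^sub>M lborel) borel (\<lambda>(x, y). Complex x y)) (box l u)
      = emeasure (lborel \<Otimes>\<^sub>M lborel) ({Re l<..<Re u} \<times> {Im l<..<Im u})"
    by (subst emeasure_distr) (simp_all only: vimg, measurable)
  also have "\<dots> = ennreal (Re u - Re l) * ennreal (Im u - Im l)"
    using le by (subst lborel.emeasure_pair_measure_Times) auto
  also have "\<dots> = ennreal (\<Prod>b\<in>Basis. (u - l) \<bullet> b)"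
    using le by (simp add: Basis_complex_def ennreal_mult)
  finally show "emeasure (distr (lborel \<Otimes>\<^sub>M lborel) borel (\<lambda>(x, y). Complex x y)) (box l u)
      = ennreal (\<Prod>b\<in>Basis. (u - l) \<bullet> b)" .
qed simp

lemma nn_integral_complex:
  assumes [measurable]: "f \<in> borel_measurable borel"
  shows "(\<integral>\<^sup>+z. f z \<partial>(lborel :: complex measure)) = (\<integral>\<^sup>+x. \<integral>\<^sup>+y. f (Complex x y) \<partial>lborel \<partial>lborel)"
proof -
  have "(\<integral>\<^sup>+z. f z \<partial>(lborel :: complex measure))
      = (\<integral>\<^sup>+p. f (case p of (x, y) \<Rightarrow> Complex x y) \<partial>(lborel \<Otimes>\<^sub>M lborel))"
    by (subst lborel_complex, subst nn_integral_distr) (auto simp: case_prod_beta)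
  also have "\<dots> = (\<integral>\<^sup>+x. \<integral>\<^sup>+y. f (Complex x y) \<partial>lborel \<partial>lborel)"
    by (subst lborel.nn_integral_fst[symmetric]) auto
  finally show ?thesis .
qed

lemma nn_integral_complex':
  assumes [measurable]: "f \<in> borel_measurable borel"
  shows "(\<integral>\<^sup>+z. f z \<partial>(lborel :: complex measure)) = (\<integral>\<^sup>+y. \<integral>\<^sup>+x. f (Complex x y) \<partial>lborel \<partial>lborel)"
proof -
  have m: "(\<lambda>(x, y). f (Complex x y)) \<in> borel_measurable (lborel \<Otimes>\<^sub>M lborel)"
    by (auto simp: case_prod_beta)
  have "(\<integral>\<^sup>+y. \<integral>\<^sup>+x. f (Complex x y) \<partial>lborel \<partial>lborel) = (\<integral>\<^sup>+x. \<integral>\<^sup>+y. f (Complex x y) \<partial>lborel \<partial>lborel)"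
    by (rule lborel_pair.Fubini'[OF m])
  then show ?thesis by (simp add: nn_integral_complex)
qed

lemma nn_integral_lborel_translate:
  assumes [measurable]: "g \<in> borel_measurable borel"
  shows "(\<integral>\<^sup>+x. g (x + c) \<partial>lborel) = (\<integral>\<^sup>+x. g x \<partial>(lborel :: 'a::euclidean_space measure))"
proof -
  have "(\<integral>\<^sup>+x. g x \<partial>lborel) = (\<integral>\<^sup>+x. g x \<partial>distr lborel borel ((+) c))"
    by (simp add: lborel_distr_plus)
  also have "\<dots> = (\<integral>\<^sup>+x. g (c + x) \<partial>lborel)"
    by (subst nn_integral_distr) auto
  finally show ?thesis by (simp add: add.commute)
qed

text \<open>
  By Fubini a shear is a family of one-dimensional translations.
\<close>

lemma nn_integral_shear_Re:
  assumes [measurable]: "f \<in> borel_measurable borel"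
  shows "(\<integral>\<^sup>+z. f (Complex (Re z + c * Im z) (Im z)) \<partial>lborel) = (\<integral>\<^sup>+z. f z \<partial>lborel)"
proof -
  have "(\<integral>\<^sup>+z. f (Complex (Re z + c * Im z) (Im z)) \<partial>lborel)
      = (\<integral>\<^sup>+y. \<integral>\<^sup>+x. f (Complex (x + c * y) y) \<partial>lborel \<partial>lborel)"
    by (subst nn_integral_complex') auto
  also have "\<dots> = (\<integral>\<^sup>+y. \<integral>\<^sup>+x. f (Complex x y) \<partial>lborel \<partial>lborel)"
    by (intro nn_integral_cong nn_integral_lborel_translate[where g = "\<lambda>x. f (Complex x _)"]) auto
  finally show ?thesis by (subst nn_integral_complex') auto
qed

lemma nn_integral_shear_Im:
  assumes [measurable]: "f \<in> borel_measurable borel"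
  shows "(\<integral>\<^sup>+z. f (Complex (Re z) (Im z + c * Re z)) \<partial>lborel) = (\<integral>\<^sup>+z. f z \<partial>lborel)"
proof -
  have "(\<integral>\<^sup>+z. f (Complex (Re z) (Im z + c * Re z)) \<partial>lborel)
      = (\<integral>\<^sup>+x. \<integral>\<^sup>+y. f (Complex x (y + c * x)) \<partial>lborel \<partial>lborel)"
    by (subst nn_integral_complex) auto
  also have "\<dots> = (\<integral>\<^sup>+x. \<integral>\<^sup>+y. f (Complex x y) \<partial>lborel \<partial>lborel)"
    by (intro nn_integral_cong nn_integral_lborel_translate[where g = "\<lambda>y. f (Complex _ y)"]) auto
  finally show ?thesis by (subst nn_integral_complex) auto
qed

text \<open>
  Rotations are handled without a change of variables theorem: a rotation other than the half turn
  is a product of three shears.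
\<close>

lemma nn_integral_rotate_aux:
  assumes [measurable]: "f \<in> borel_measurable borel" and "cmod \<omega> = 1" and "\<omega> \<noteq> -1"
  shows "(\<integral>\<^sup>+z. f (\<omega> * z) \<partial>lborel) = (\<integral>\<^sup>+z. f z \<partial>lborel)"
proof -
  define p q where "p = Re \<omega>" and "q = Im \<omega>"
  have pq: "p\<^sup>2 + q\<^sup>2 = 1"
    using assms(2) by (simp add: p_def q_def cmod_def)
  have p1: "1 + p \<noteq> 0"
  proof
    assume "1 + p = 0"
    then have p: "p = -1" by simp
    then have "q = 0" using pq by simp
    with p have "\<omega> = -1" by (simp add: complex_eq_iff p_def q_def)
    with assms(3) show False ..
  qed
  \<comment> \<open>minus the tangent of half the angle; the three shears have parameters \<open>a\<close>, \<open>q\<close>, \<open>a\<close>\<close>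
  define a where "a = - q / (1 + p)"
  have aq: "1 + a * q = p"
  proof -
    have "a * q * (1 + p) = - q\<^sup>2" using p1 by (simp add: a_def power2_eq_square)
    also have "\<dots> = (p - 1) * (1 + p)" using pq by (simp add: power2_eq_square algebra_simps)
    finally show ?thesis using p1 by simp
  qed
  have a1p: "a * (1 + p) = - q" using p1 by (simp add: a_def)
  let ?X = "\<lambda>z. Complex (Re z + a * Im z) (Im z)"
  let ?Y = "\<lambda>z. Complex (Re z) (Im z + q * Re z)"
  have rot: "\<omega> * z = ?X (?Y (?X z))" for z
  proof (rule complex_eqI)
    have "Re (?X (?Y (?X z))) = (1 + a * q) * Re z + (a * (1 + (1 + a * q))) * Im z"
      by (simp add: algebra_simps)
    also have "\<dots> = p * Re z - q * Im z" unfolding aq a1p by simp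
    finally show "Re (\<omega> * z) = Re (?X (?Y (?X z)))" by (simp add: p_def q_def)
    have "Im (?X (?Y (?X z))) = q * Re z + (1 + a * q) * Im z"
      by (simp add: algebra_simps)
    then show "Im (\<omega> * z) = Im (?X (?Y (?X z)))" unfolding aq by (simp add: p_def q_def)
  qed
  have "(\<integral>\<^sup>+z. f (\<omega> * z) \<partial>lborel) = (\<integral>\<^sup>+z. f (?X (?Y (?X z))) \<partial>lborel)"
    by (simp only: rot)
  also have "\<dots> = (\<integral>\<^sup>+z. f (?X (?Y z)) \<partial>lborel)"
    by (rule nn_integral_shear_Re[where f = "\<lambda>z. f (?X (?Y z))"]) measurable
  also have "\<dots> = (\<integral>\<^sup>+z. f (?X z) \<partial>lborel)"
    by (rule nn_integral_shear_Im[where f = "\<lambda>z. f (?X z)"]) measurable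
  also have "\<dots> = (\<integral>\<^sup>+z. f z \<partial>lborel)"
    by (rule nn_integral_shear_Re) measurable
  finally show ?thesis .
qed

lemma nn_integral_rotate:
  assumes [measurable]: "f \<in> borel_measurable borel" and "cmod \<omega> = 1"
  shows "(\<integral>\<^sup>+z. f (\<omega> * z) \<partial>lborel) = (\<integral>\<^sup>+z. f z \<partial>lborel)"
proof (cases "\<omega> = -1")
  case True
  have "(\<integral>\<^sup>+z. f (\<omega> * z) \<partial>lborel) = (\<integral>\<^sup>+z. f (\<i> * (\<i> * z)) \<partial>lborel)"
    by (simp add: True flip: mult.assoc)
  also have "\<dots> = (\<integral>\<^sup>+z. f (\<i> * z) \<partial>lborel)"
    by (rule nn_integral_rotate_aux[where f = "\<lambda>z. f (\<i> * z)"]) (auto simp: complex_eq_iff)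
  also have "\<dots> = (\<integral>\<^sup>+z. f z \<partial>lborel)"
    by (rule nn_integral_rotate_aux) (auto simp: complex_eq_iff)
  finally show ?thesis .
qed (use assms nn_integral_rotate_aux in auto)

lemma lborel_distr_rotate:
  assumes "cmod \<omega> = 1"
  shows "distr lborel borel ((*) \<omega>) = (lborel :: complex measure)"
proof (rule measure_eqI)
  fix A :: "complex set" assume "A \<in> sets (distr lborel borel ((*) \<omega>))"
  then have A[measurable]: "A \<in> sets borel" by simp
  have "emeasure (distr lborel borel ((*) \<omega>)) A = (\<integral>\<^sup>+z. indicator A z \<partial>distr lborel borel ((*) \<omega>))"
    by simp
  also have "\<dots> = (\<integral>\<^sup>+z. indicator A (\<omega> * z) \<partial>lborel)"
    by (subst nn_integral_distr) auto
  also have "\<dots> = emeasure lborel A"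
    using nn_integral_rotate[of "indicator A" \<omega>] assms by simp
  finally show "emeasure (distr lborel borel ((*) \<omega>)) A = emeasure lborel A" .
qed simp

lemma integral_rotate:
  fixes f :: "complex \<Rightarrow> 'b::{banach, second_countable_topology}"
  assumes "cmod \<omega> = 1" and [measurable]: "f \<in> borel_measurable borel"
  shows "(\<integral>z. f (\<omega> * z) \<partial>lborel) = (\<integral>z. f z \<partial>lborel)"
  by (subst (2) lborel_distr_rotate[OF assms(1), symmetric], subst integral_distr) auto

lemma integral_translate:
  fixes f :: "complex \<Rightarrow> 'b::{banach, second_countable_topology}"
  assumes [measurable]: "f \<in> borel_measurable borel"
  shows "(\<integral>z. f (c + z) \<partial>lborel) = (\<integral>z. f z \<partial>lborel)"
  by (subst (2) lborel_distr_plus[of c, symmetric], subst integral_distr) auto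

lemma integrable_translate:
  fixes f :: "complex \<Rightarrow> 'b::{banach, second_countable_topology}"
  assumes "integrable lborel f"
  shows "integrable lborel (\<lambda>z. f (c + z))"
proof -
  have "integrable (distr lborel borel ((+) c)) f"
    using assms by (simp add: lborel_distr_plus)
  then show ?thesis by (subst (asm) integrable_distr_eq) (use assms in auto)
qed

section \<open>Gaussian integrals\<close>

lemma has_bochner_integral_complex_prod:
  fixes f g :: "real \<Rightarrow> real"
  assumes f: "has_bochner_integral lborel f a" and g: "has_bochner_integral lborel g b"
  shows "has_bochner_integral lborel (\<lambda>z. f (Re z) * g (Im z)) (a * b)"
proof -
  have [measurable]: "f \<in> borel_measurable borel" "g \<in> borel_measurable borel"
    using f g by (auto dest: borel_measurable_has_bochner_integral)
  have if_: "integrable lborel f" "integrable lborel g" and ig: "integral\<^sup>L lborel f = a" "integral\<^sup>L lborel g = b"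
    using f g by (auto simp: has_bochner_integral_iff)
  have i: "integrable (lborel \<Otimes>\<^sub>M lborel) (\<lambda>(x, y). f x * g y)"
    by (rule lborel_pair.Fubini_integrable) (use if_ in \<open>auto simp: abs_mult\<close>)
  have "integral\<^sup>L (lborel \<Otimes>\<^sub>M lborel) (\<lambda>(x, y). f x * g y) = (\<integral>x. \<integral>y. f x * g y \<partial>lborel \<partial>lborel)"
    using lborel_pair.integral_fst'[OF i] by simp
  also have "\<dots> = a * b" by (simp add: ig)
  finally have h: "has_bochner_integral (lborel \<Otimes>\<^sub>M lborel) (\<lambda>(x, y). f x * g y) (a * b)"
    using i by (simp add: has_bochner_integral_iff)
  show ?thesis
    by (subst lborel_complex, rule has_bochner_integral_distr)
       (use h in \<open>auto simp: case_prod_beta'\<close>)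
qed

lemma has_bochner_integral_gaussian_moment_real:
  assumes "c > 0"
  shows "has_bochner_integral lborel (\<lambda>x::real. x ^ (2 * k) * exp (- c * x\<^sup>2))
           (sqrt (pi / c) * fact (2 * k) / ((4 * c) ^ k * fact k))"
proof -
  \<comment> \<open>the normal density of standard deviation \<open>\<sigma>\<close> is a multiple of the given Gaussian\<close>
  define \<sigma> where "\<sigma> = 1 / sqrt (2 * c)"
  have \<sigma>: "\<sigma> > 0" using assms by (simp add: \<sigma>_def)
  have s2: "\<sigma>\<^sup>2 = 1 / (2 * c)" using assms by (simp add: \<sigma>_def power_divide)
  have dens: "sqrt (pi / c) * (normal_density 0 \<sigma> x * (x - 0) ^ (2 * k)) = x ^ (2 * k) * exp (- c * x\<^sup>2)" for x
    using assms by (simp add: normal_density_def s2 real_sqrt_divide)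
  have "has_bochner_integral lborel (\<lambda>x. sqrt (pi / c) * (normal_density 0 \<sigma> x * (x - 0) ^ (2 * k)))
          (sqrt (pi / c) * (fact (2 * k) / ((2 / \<sigma>\<^sup>2) ^ k * fact k)))"
    by (intro has_bochner_integral_mult_right normal_moment_even \<sigma>)
  then show ?thesis
    unfolding dens s2 by simp
qed

text \<open>
  The cubic term applied to first-order polynomials only meets the powers up to \<open>p = 2\<close>, for which
  expanding \<open>|z|\<^bsup>2p\<^esup>\<close> in the real coordinates is immediate.
\<close>

lemma has_bochner_integral_gaussian_moment:
  assumes "c > 0" and "p \<le> 2"
  shows "has_bochner_integral lborel (\<lambda>z. (cmod z)\<^sup>2 ^ p * exp (- c * (cmod z)\<^sup>2)) (pi * fact p / c ^ Suc p)"
proof -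
  have g: "has_bochner_integral lborel
      (\<lambda>z. (Re z ^ (2 * j) * exp (- c * (Re z)\<^sup>2)) * (Im z ^ (2 * k) * exp (- c * (Im z)\<^sup>2)))
      (pi / c * (fact (2 * j) / ((4 * c) ^ j * fact j)) * (fact (2 * k) / ((4 * c) ^ k * fact k)))" for j k
  proof -
    have "sqrt (pi / c) * fact (2 * j) / ((4 * c) ^ j * fact j) * (sqrt (pi / c) * fact (2 * k) / ((4 * c) ^ k * fact k))
        = sqrt (pi / c) * sqrt (pi / c) * (fact (2 * j) / ((4 * c) ^ j * fact j)) * (fact (2 * k) / ((4 * c) ^ k * fact k))"
      by (simp only: times_divide_eq_right times_divide_eq_left times_divide_times_eq divide_divide_eq_left ac_simps)
    also have "sqrt (pi / c) * sqrt (pi / c) = pi / c" using assms by simp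
    finally show ?thesis
      using has_bochner_integral_complex_prod[OF has_bochner_integral_gaussian_moment_real[OF assms(1), of j]
          has_bochner_integral_gaussian_moment_real[OF assms(1), of k]] by metis
  qed
  have e: "exp (- c * (cmod z)\<^sup>2) = exp (- c * (Re z)\<^sup>2) * exp (- c * (Im z)\<^sup>2)" for z
    by (simp add: cmod_power2 distrib_left flip: exp_add)
  consider "p = 0" | "p = 1" | "p = 2" using assms(2) by linarith
  then show ?thesis
  proof cases
    case 1
    show ?thesis using g[of 0 0] unfolding 1 e by simp
  next
    case 2
    have "(cmod z)\<^sup>2 ^ 1 * exp (- c * (cmod z)\<^sup>2)
        = (Re z ^ (2 * 1) * exp (- c * (Re z)\<^sup>2)) * (Im z ^ (2 * 0) * exp (- c * (Im z)\<^sup>2))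
         + (Re z ^ (2 * 0) * exp (- c * (Re z)\<^sup>2)) * (Im z ^ (2 * 1) * exp (- c * (Im z)\<^sup>2))" for z
      unfolding e unfolding cmod_power2 by (simp add: algebra_simps power2_eq_square)
    moreover have "pi / c * (fact (2 * 1) / ((4 * c)^1 * fact 1)) * (fact (2 * 0) / ((4 * c) ^ 0 * fact 0))
        + pi / c * (fact (2 * 0) / ((4 * c)^0 * fact 0)) * (fact (2 * 1) / ((4 * c) ^ 1 * fact 1))
        = pi * fact p / c ^ Suc p"
      using assms(1) by (simp add: 2 fact_numeral field_simps power2_eq_square)
    ultimately show ?thesis
      using has_bochner_integral_add[OF g[of 1 0] g[of 0 1]] by (simp only: 2)
  next
    case 3
    have "(cmod z)\<^sup>2 ^ 2 * exp (- c * (cmod z)\<^sup>2)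
        = (Re z ^ (2 * 2) * exp (- c * (Re z)\<^sup>2)) * (Im z ^ (2 * 0) * exp (- c * (Im z)\<^sup>2))
         + (Re z ^ (2 * 0) * exp (- c * (Re z)\<^sup>2)) * (Im z ^ (2 * 2) * exp (- c * (Im z)\<^sup>2))
         + 2 * ((Re z ^ (2 * 1) * exp (- c * (Re z)\<^sup>2)) * (Im z ^ (2 * 1) * exp (- c * (Im z)\<^sup>2)))" for z
      unfolding e unfolding cmod_power2 by (simp add: algebra_simps power2_eq_square power4_eq_xxxx)
    moreover have "pi / c * (fact (2 * 2) / ((4 * c)^2 * fact 2)) * (fact (2 * 0) / ((4 * c) ^ 0 * fact 0))
        + pi / c * (fact (2 * 0) / ((4 * c)^0 * fact 0)) * (fact (2 * 2) / ((4 * c) ^ 2 * fact 2))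
        + 2 * (pi / c * (fact (2 * 1) / ((4 * c)^1 * fact 1)) * (fact (2 * 1) / ((4 * c) ^ 1 * fact 1)))
        = pi * fact p / c ^ Suc p"
      using assms(1) by (simp add: 3 fact_numeral field_simps power2_eq_square power3_eq_cube)
    ultimately show ?thesis
      using has_bochner_integral_add[OF has_bochner_integral_add[OF g[of 2 0] g[of 0 2]]
          has_bochner_integral_mult_right[OF g[of 1 1], of 2]] by (simp only: 3)
  qed
qed

text \<open>
  The integrability criterion used throughout: the quadratic decay beats every exponential of the
  modulus, by completing the square.
\<close>

lemma integrable_gaussian_bound:
  fixes f :: "complex \<Rightarrow> 'b::{banach, second_countable_topology}"
  assumes c: "c > 0" and m: "f \<in> borel_measurable borel"
    and b: "\<And>z. norm (f z) \<le> C * exp (k * cmod z - c * (cmod z)\<^sup>2)"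
  shows "integrable lborel f"
proof (rule Bochner_Integration.integrable_bound)
  have "integrable lborel (\<lambda>z. exp (- (c / 2) * (cmod z)\<^sup>2))"
    using has_bochner_integral_gaussian_moment[of "c / 2" 0] c by (simp add: has_bochner_integral_iff)
  then show "integrable lborel (\<lambda>z. (\<bar>C\<bar> * exp (k\<^sup>2 / (2 * c))) * exp (- (c / 2) * (cmod z)\<^sup>2))"
    by (rule integrable_mult_right)
  show "AE z in lborel. norm (f z) \<le> norm ((\<bar>C\<bar> * exp (k\<^sup>2 / (2 * c))) * exp (- (c / 2) * (cmod z)\<^sup>2))"
  proof (intro AE_I2)
    fix z
    have "k\<^sup>2 / (2 * c) + - (c / 2) * (cmod z)\<^sup>2 - (k * cmod z - c * (cmod z)\<^sup>2) = (k - c * cmod z)\<^sup>2 / (2 * c)"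
      using c by (simp add: field_simps power2_eq_square)
    also have "\<dots> \<ge> 0" using c by simp
    finally have "exp (k * cmod z - c * (cmod z)\<^sup>2) \<le> exp (k\<^sup>2 / (2 * c)) * exp (- (c / 2) * (cmod z)\<^sup>2)"
      unfolding exp_add[symmetric] by simp
    then have "\<bar>C\<bar> * exp (k * cmod z - c * (cmod z)\<^sup>2) \<le> \<bar>C\<bar> * (exp (k\<^sup>2 / (2 * c)) * exp (- (c / 2) * (cmod z)\<^sup>2))"
      by (intro mult_left_mono) auto
    moreover have "C * exp (k * cmod z - c * (cmod z)\<^sup>2) \<le> \<bar>C\<bar> * exp (k * cmod z - c * (cmod z)\<^sup>2)"
      by (intro mult_right_mono) auto
    ultimately show "norm (f z) \<le> norm ((\<bar>C\<bar> * exp (k\<^sup>2 / (2 * c))) * exp (- (c / 2) * (cmod z)\<^sup>2))"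
      using b[of z] unfolding real_norm_def abs_mult abs_abs abs_exp_cancel mult.assoc by linarith
  qed
qed (use m in simp)

text \<open>
  Rotating by the angle \<open>\<pi> / (n - m)\<close> multiplies the integrand by \<open>-1\<close>, so the integral equals
  its own negative.
\<close>

lemma integral_monomial_radial:
  fixes G :: "real \<Rightarrow> complex"
  assumes [measurable]: "G \<in> borel_measurable borel" and "m \<noteq> n"
  shows "(\<integral>w. cnj w ^ m * w ^ n * G (cmod w) \<partial>lborel) = 0"
proof -
  define \<theta> where "\<theta> = pi / (real n - real m)"
  define \<omega> where "\<omega> = cis \<theta>"
  let ?I = "\<integral>w. cnj w ^ m * w ^ n * G (cmod w) \<partial>lborel"
  have "cnj \<omega> ^ m * \<omega> ^ n = cis (- (real m * \<theta>)) * cis (real n * \<theta>)"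
    by (simp add: \<omega>_def cis_cnj Complex.DeMoivre)
  also have "\<dots> = cis ((real n - real m) * \<theta>)" by (simp add: cis_mult algebra_simps)
  also have "(real n - real m) * \<theta> = pi" using assms(2) by (simp add: \<theta>_def)
  finally have \<omega>: "cnj \<omega> ^ m * \<omega> ^ n = -1" by simp
  have "?I = (\<integral>w. cnj (\<omega> * w) ^ m * (\<omega> * w) ^ n * G (cmod (\<omega> * w)) \<partial>lborel)"
    by (rule integral_rotate[symmetric]) (auto simp: \<omega>_def)
  also have "\<dots> = (\<integral>w. (cnj \<omega> ^ m * \<omega> ^ n) * (cnj w ^ m * w ^ n * G (cmod w)) \<partial>lborel)"
    by (rule Bochner_Integration.integral_cong) (auto simp: power_mult_distrib norm_mult \<omega>_def)
  also have "\<dots> = - ?I" unfolding \<omega> by simp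
  finally show ?thesis by simp
qed

lemma power_le_fact_exp:
  fixes x :: real
  assumes "x \<ge> 0"
  shows "x ^ n \<le> fact n * exp x"
proof -
  have "(\<Sum>k\<in>{n}. x ^ k /\<^sub>R fact k) \<le> exp x"
    unfolding exp_def using assms by (intro sum_le_suminf summable_exp_generic) auto
  then show ?thesis by (simp add: field_simps)
qed

text \<open>
  Expanding the reproducing kernel in powers of \<open>cnj w\<close>, orthogonality leaves the single term in
  which the powers of \<open>w\<close> and \<open>cnj w\<close> agree, namely the one of index \<open>p - q\<close>.
\<close>

lemma integral_fock_kernel_monomial:
  assumes p: "p \<le> 2"
  shows "(\<integral>w. exp (cnj w * z) * (w ^ p * cnj w ^ q * of_real (exp (- 2 * (cmod w)\<^sup>2))) \<partial>lborel)
         = (if q \<le> p then z ^ (p - q) / fact (p - q) * of_real (pi * fact p / 2 ^ Suc p) else 0)"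
    (is "integral\<^sup>L lborel ?f = ?R")
    and "integrable lborel (\<lambda>w. exp (cnj w * z) * (w ^ p * cnj w ^ q * of_real (exp (- 2 * (cmod w)\<^sup>2))))"
proof -
  let ?h = "\<lambda>w. w ^ p * cnj w ^ q * of_real (exp (- 2 * (cmod w)\<^sup>2))"
  let ?s = "\<lambda>N w. (\<Sum>n<N. (cnj w * z) ^ n /\<^sub>R fact n) * ?h w"
  let ?b = "\<lambda>w. exp (cmod w * cmod z) * (cmod w ^ (p + q) * exp (- 2 * (cmod w)\<^sup>2))"
  have b: "integrable lborel ?b"
  proof (rule integrable_gaussian_bound[where c = 2 and C = "fact (p + q)" and k = "1 + cmod z"])
    fix w
    have "cmod w ^ (p + q) \<le> fact (p + q) * exp (cmod w)"
      by (rule power_le_fact_exp) simp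
    then have "exp (cmod w * cmod z) * (cmod w ^ (p + q) * exp (- 2 * (cmod w)\<^sup>2))
       \<le> exp (cmod w * cmod z) * ((fact (p + q) * exp (cmod w)) * exp (- 2 * (cmod w)\<^sup>2))"
      by (intro mult_left_mono mult_right_mono) auto
    also have "\<dots> = fact (p + q) * exp ((1 + cmod z) * cmod w - 2 * (cmod w)\<^sup>2)"
      by (simp add: exp_add exp_diff exp_minus algebra_simps divide_inverse)
    finally show "norm (?b w) \<le> fact (p + q) * exp ((1 + cmod z) * cmod w - 2 * (cmod w)\<^sup>2)" by simp
  qed auto
  have sb: "norm (?s N w) \<le> ?b w" for N w
  proof -
    have "norm (\<Sum>n<N. (cnj w * z) ^ n /\<^sub>R fact n) \<le> (\<Sum>n<N. (cmod w * cmod z) ^ n /\<^sub>R fact n)"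
      by (rule order_trans[OF norm_sum]) (simp add: norm_power norm_mult)
    also have "\<dots> \<le> exp (cmod w * cmod z)"
      unfolding exp_def by (intro sum_le_suminf summable_exp_generic) auto
    finally show ?thesis
      unfolding norm_mult by (intro mult_mono) (auto simp: norm_mult norm_power power_add)
  qed
  have lim: "(\<lambda>N. ?s N w) \<longlonglongrightarrow> ?f w" for w
    using exp_converges[of "cnj w * z"] by (intro tendsto_intros) (simp add: sums_def)
  show "integrable lborel ?f"
    by (rule integrable_dominated_convergence[where s = ?s and w = ?b]) (use b sb lim in auto)
  have conv: "(\<lambda>N. integral\<^sup>L lborel (?s N)) \<longlonglongrightarrow> integral\<^sup>L lborel ?f"
    by (rule integral_dominated_convergence[where w = ?b]) (use b sb lim in auto)
  have int: "integrable lborel (\<lambda>w. cnj w ^ (n + q) * w ^ p * of_real (exp (- 2 * (cmod w)\<^sup>2)))" for n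
  proof (rule integrable_gaussian_bound[where c = 2 and C = "fact (n + q + p)" and k = 1])
    fix w
    have "cmod w ^ (n + q + p) * exp (- 2 * (cmod w)\<^sup>2) \<le> fact (n + q + p) * exp (cmod w) * exp (- 2 * (cmod w)\<^sup>2)"
      by (intro mult_right_mono power_le_fact_exp) auto
    then show "norm (cnj w ^ (n + q) * w ^ p * of_real (exp (- 2 * (cmod w)\<^sup>2)))
        \<le> fact (n + q + p) * exp (1 * cmod w - 2 * (cmod w)\<^sup>2)"
      by (simp add: norm_mult norm_power power_add exp_diff exp_minus divide_inverse mult.assoc norm_inverse
          flip: of_real_inverse)
  qed auto
  have term_int: "(\<integral>w. cnj w ^ (n + q) * w ^ p * of_real (exp (- 2 * (cmod w)\<^sup>2)) \<partial>lborel)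
     = (if n + q = p then of_real (pi * fact p / 2 ^ Suc p) else (0::complex))" for n
  proof (cases "n + q = p")
    case True
    have "(\<integral>w. cnj w ^ p * w ^ p * of_real (exp (- 2 * (cmod w)\<^sup>2)) \<partial>lborel)
        = (\<integral>w. complex_of_real ((cmod w)\<^sup>2 ^ p * exp (- 2 * (cmod w)\<^sup>2)) \<partial>lborel)"
      by (rule Bochner_Integration.integral_cong)
         (simp_all add: mult.commute[of "cnj _"] flip: power_mult_distrib complex_norm_square)
    also have "\<dots> = of_real (pi * fact p / 2 ^ Suc p)"
      using has_bochner_integral_gaussian_moment[of 2 p] p
      by (subst integral_complex_of_real) (simp add: has_bochner_integral_iff)
    finally show ?thesis using True by simp
  next
    case False
    then show ?thesis
      using integral_monomial_radial[of "\<lambda>r. of_real (exp (- 2 * r\<^sup>2))" "n + q" p] by simp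
  qed
  have "integral\<^sup>L lborel (?s N) = ?R" if "N > p" for N
  proof -
    have "integral\<^sup>L lborel (?s N)
        = (\<integral>w. (\<Sum>n<N. (z ^ n /\<^sub>R fact n) * (cnj w ^ (n + q) * w ^ p * of_real (exp (- 2 * (cmod w)\<^sup>2)))) \<partial>lborel)"
      unfolding sum_distrib_right
      by (intro Bochner_Integration.integral_cong sum.cong refl)
         (simp add: power_mult_distrib power_add scaleR_conv_of_real ac_simps)
    also have "\<dots> = (\<Sum>n<N. (z ^ n /\<^sub>R fact n) * (if n + q = p then of_real (pi * fact p / 2 ^ Suc p) else 0))"
      by (subst Bochner_Integration.integral_sum) (use int in \<open>auto simp only: term_int integral_mult_right_zero intro!: integrable_mult_right\<close>)
    also have "\<dots> = ?R"
    proof (cases "q \<le> p")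
      case True
      have "(\<Sum>n<N. (z ^ n /\<^sub>R fact n) * (if n + q = p then of_real (pi * fact p / 2 ^ Suc p) else 0))
          = (\<Sum>n<N. if n = p - q then (z ^ n /\<^sub>R fact n) * of_real (pi * fact p / 2 ^ Suc p) else 0)"
      proof (intro sum.cong refl)
        fix n
        have "n + q = p \<longleftrightarrow> n = p - q" using True by linarith
        then show "(z ^ n /\<^sub>R fact n) * (if n + q = p then of_real (pi * fact p / 2 ^ Suc p) else 0)
          = (if n = p - q then (z ^ n /\<^sub>R fact n) * of_real (pi * fact p / 2 ^ Suc p) else 0)"
          by (cases "n = p - q") (simp_all only: mult_zero_right if_True if_False simp_thms)
      qed
      also have "\<dots> = ?R"
        using True that by (simp add: scaleR_conv_of_real field_simps)
      finally show ?thesis .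
    next
      case False
      then show ?thesis by (auto intro!: sum.neutral)
    qed
    finally show ?thesis .
  qed
  then have "(\<lambda>N. integral\<^sup>L lborel (?s N)) \<longlonglongrightarrow> ?R"
    by (intro tendsto_eventually eventually_at_top_linorderI[of "Suc p"]) auto
  with conv show "integral\<^sup>L lborel ?f = ?R" by (rule LIMSEQ_unique)
qed

section \<open>Point evaluations on the Bargmann-Fock space\<close>

text \<open>
  Integrating the Taylor series over the disc, all terms but the constant one vanish by rotation
  invariance.
\<close>

lemma mean_value_disc:
  assumes f: "f holomorphic_on UNIV"
  shows "(\<integral>w. indicator {..1} (cmod w) * f w \<partial>lborel) = of_real pi * f 0"
proof -
  define a where "a n = (deriv ^^ n) f 0 / fact n" for n
  have sums: "(\<lambda>n. a n * w ^ n) sums f w" for w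
    using holomorphic_power_series[of f 0 "cmod w + 1" w] f
    by (auto simp: a_def intro: holomorphic_on_subset)
  have summable_a: "summable (\<lambda>n. cmod (a n))"
    using powser_insidea[OF sums_summable[OF sums[of 2]], of 1] by simp
  let ?s = "\<lambda>N w. \<Sum>n<N. indicator {..1} (cmod w) * (a n * w ^ n)"
  let ?b = "\<lambda>w::complex. indicator (cball 0 1) w * (\<Sum>n. cmod (a n))"
  have fin: "emeasure lborel (cball (0::complex) 1) < \<infinity>"
    by (rule emeasure_bounded_finite) simp
  have ind_int: "integrable lborel (\<lambda>w::complex. indicator (cball 0 1) w :: real)"
    using fin by simp
  have b: "integrable lborel ?b"
    by (intro integrable_mult_left ind_int)
  have fm: "f \<in> borel_measurable borel"
    using f by (intro borel_measurable_continuous_onI holomorphic_on_imp_continuous_on)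
  have sb: "norm (?s N w) \<le> ?b w" for N w
  proof (cases "cmod w \<le> 1")
    case True
    have "norm (\<Sum>n<N. a n * w ^ n) \<le> (\<Sum>n<N. cmod (a n) * cmod w ^ n)"
      by (rule order_trans[OF norm_sum]) (simp add: norm_mult norm_power)
    also have "\<dots> \<le> (\<Sum>n<N. cmod (a n))"
      using True by (intro sum_mono mult_left_le power_le_one) auto
    also have "\<dots> \<le> (\<Sum>n. cmod (a n))"
      by (rule sum_le_suminf[OF summable_a]) auto
    finally show ?thesis using True by simp
  qed simp
  have lim: "(\<lambda>N. ?s N w) \<longlonglongrightarrow> indicator {..1} (cmod w) * f w" for w
    using sums[of w] unfolding sum_distrib_left[symmetric] by (intro tendsto_intros) (simp add: sums_def)
  have sm: "?s N \<in> borel_measurable lborel" for N by measurable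
  have conv: "(\<lambda>N. integral\<^sup>L lborel (?s N)) \<longlonglongrightarrow> (\<integral>w. indicator {..1} (cmod w) * f w \<partial>lborel)"
    by (rule integral_dominated_convergence[where w = ?b])
       (use b sb lim sm fm in auto)
  have term_integrable: "integrable lborel (\<lambda>w. indicator {..1} (cmod w) * (a n * w ^ n))" for n
  proof (rule Bochner_Integration.integrable_bound[OF integrable_mult_right[OF ind_int, of "cmod (a n)"]])
    show "AE w in lborel. norm (indicator {..1} (cmod w) * (a n * w ^ n)) \<le> norm (cmod (a n) * indicator (cball 0 1) w)"
      by (intro AE_I2) (auto simp: norm_mult norm_power indicator_def intro!: mult_left_le power_le_one)
  qed measurable
  have term0: "(\<integral>w. indicator {..1} (cmod w) * (a n * w ^ n) \<partial>lborel) = 0" if "n > 0" for n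
  proof -
    have "(\<integral>w. indicator {..1} (cmod w) * (a n * w ^ n) \<partial>lborel)
        = a n * (\<integral>w. cnj w ^ 0 * w ^ n * indicator {..1} (cmod w) \<partial>lborel)"
      by (subst integral_mult_right_zero[symmetric]) (simp add: ac_simps)
    also have "(\<integral>w. cnj w ^ 0 * w ^ n * indicator {..1} (cmod w) \<partial>lborel) = 0"
      by (rule integral_monomial_radial) (use that in auto)
    finally show ?thesis by simp
  qed
  have disc: "(\<integral>w. indicator {..1} (cmod w) \<partial>lborel) = (of_real pi :: complex)"
  proof -
    have "(\<integral>w. indicator {..1} (cmod w) \<partial>lborel) = (\<integral>w. of_real (indicator (cball (0::complex) 1) w) \<partial>lborel :: complex)"
      by (rule Bochner_Integration.integral_cong) (auto simp: indicator_def)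
    also have "\<dots> = of_real (measure lborel (cball (0::complex) 1))"
      by (subst integral_complex_of_real) simp
    also have "measure lborel (cball (0::complex) 1) = pi"
      by (simp add: content_cball unit_ball_vol_2)
    finally show ?thesis .
  qed
  have "integral\<^sup>L lborel (?s (Suc N)) = of_real pi * f 0" for N
  proof -
    have "integral\<^sup>L lborel (?s (Suc N)) = (\<Sum>n<Suc N. \<integral>w. indicator {..1} (cmod w) * (a n * w ^ n) \<partial>lborel)"
      by (rule Bochner_Integration.integral_sum) (rule term_integrable)
    also have "\<dots> = (\<integral>w. indicator {..1} (cmod w) * (a 0 * w ^ 0) \<partial>lborel)"
      by (subst sum.lessThan_Suc_shift) (simp add: term0 del: power_Suc)
    also have "\<dots> = of_real pi * f 0"
      by (simp add: disc a_def)
    finally show ?thesis .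
  qed
  then have "(\<lambda>N. integral\<^sup>L lborel (?s (Suc N))) \<longlonglongrightarrow> of_real pi * f 0" by simp
  then show ?thesis
    using LIMSEQ_unique[OF LIMSEQ_Suc[OF conv]] by simp
qed

text \<open>
  Applying the mean value property to \<open>f\<^sup>2\<close> instead of \<open>f\<close> yields the \<open>L\<^sup>2\<close> bound directly, without
  the Cauchy-Schwarz inequality. The factor \<open>e\<close> bounds \<open>exp(|w|\<^sup>2)\<close> on the unit disc.
\<close>

lemma gaussian_evaluation_bound:
  assumes f: "f holomorphic_on UNIV"
    and int: "integrable lborel (\<lambda>w. (cmod (f w))\<^sup>2 * exp (- (cmod w)\<^sup>2))"
  shows "(cmod (f 0))\<^sup>2 \<le> exp 1 / pi * (\<integral>w. (cmod (f w))\<^sup>2 * exp (- (cmod w)\<^sup>2) \<partial>lborel)"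
proof -
  let ?g = "\<lambda>w. (cmod (f w))\<^sup>2 * exp (- (cmod w)\<^sup>2)"
  have fm[measurable]: "f \<in> borel_measurable borel"
    using f by (intro borel_measurable_continuous_onI holomorphic_on_imp_continuous_on)
  have le: "norm (indicator {..1} (cmod w) * (f w)\<^sup>2) \<le> exp 1 * ?g w" for w
  proof (cases "cmod w \<le> 1")
    case True
    then have "1 \<le> exp (1 - (cmod w)\<^sup>2)" by (simp add: power_le_one)
    then have "(cmod (f w))\<^sup>2 * 1 \<le> (cmod (f w))\<^sup>2 * exp (1 - (cmod w)\<^sup>2)"
      by (intro mult_left_mono) auto
    then show ?thesis using True by (simp add: norm_power exp_diff exp_minus field_simps)
  qed simp
  have i1: "integrable lborel (\<lambda>w. exp 1 * ?g w)" using int by (rule integrable_mult_right)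
  have i2: "integrable lborel (\<lambda>w. indicator {..1} (cmod w) * (f w)\<^sup>2)"
    by (rule Bochner_Integration.integrable_bound[OF i1]) (use le in \<open>auto intro!: AE_I2 order_trans[OF le]\<close>)
  have "pi * (cmod (f 0))\<^sup>2 = norm (\<integral>w. indicator {..1} (cmod w) * (f w)\<^sup>2 \<partial>lborel)"
    by (subst mean_value_disc) (auto intro!: holomorphic_intros f simp: norm_mult norm_power)
  also have "\<dots> \<le> (\<integral>w. norm (indicator {..1} (cmod w) * (f w)\<^sup>2) \<partial>lborel)"
    by (rule integral_norm_bound)
  also have "\<dots> \<le> (\<integral>w. exp 1 * ?g w \<partial>lborel)"
    by (rule integral_mono) (use i1 i2 le in auto)
  finally show ?thesis by (simp add: field_simps)
qed

lemma square_integrable_add: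
  assumes "square_integrable u" "square_integrable v"
  shows "square_integrable (\<lambda>z. u z + v z)"
proof -
  have [measurable]: "u \<in> borel_measurable lborel" "v \<in> borel_measurable lborel"
    using assms by (auto simp: square_integrable_def)
  have i: "integrable lborel (\<lambda>z. 2 * (cmod (u z))\<^sup>2 + 2 * (cmod (v z))\<^sup>2)"
    using assms by (auto simp: square_integrable_def)
  have "integrable lborel (\<lambda>z. (cmod (u z + v z))\<^sup>2)"
  proof (rule Bochner_Integration.integrable_bound[OF i], measurable, intro AE_I2)
    fix z
    have "(cmod (u z + v z))\<^sup>2 \<le> (cmod (u z) + cmod (v z))\<^sup>2"
      by (intro power_mono norm_triangle_ineq) auto
    also have "\<dots> \<le> 2 * (cmod (u z))\<^sup>2 + 2 * (cmod (v z))\<^sup>2"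
      using sum_squares_bound[of "cmod (u z)" "cmod (v z)"] by (simp add: power2_sum)
    finally show "norm ((cmod (u z + v z))\<^sup>2) \<le> norm (2 * (cmod (u z))\<^sup>2 + 2 * (cmod (v z))\<^sup>2)"
      by simp
  qed
  then show ?thesis by (simp add: square_integrable_def)
qed

lemma square_integrable_mult:
  assumes "square_integrable u"
  shows "square_integrable (\<lambda>z. c * u z)"
  using assms by (auto simp: square_integrable_def norm_mult power_mult_distrib)

lemma bargmann_fockI:
  assumes "f holomorphic_on UNIV" "\<And>z. u z = exp (- of_real ((cmod z)\<^sup>2 / 2)) * f z" "square_integrable u"
  shows "u \<in> bargmann_fock"
  using assms by (auto simp: bargmann_fock_def fun_eq_iff intro!: exI[of _ f])

lemma bargmann_fockE:
  assumes "u \<in> bargmann_fock"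
  obtains f where "f holomorphic_on UNIV" "\<forall>z. u z = exp (- of_real ((cmod z)\<^sup>2 / 2)) * f z"
    "square_integrable u"
  using assms by (auto simp: bargmann_fock_def)

lemma bargmann_fock_square_integrable: "u \<in> bargmann_fock \<Longrightarrow> square_integrable u"
  by (auto simp: bargmann_fock_def)

lemma bargmann_fock_add:
  assumes "u \<in> bargmann_fock" "v \<in> bargmann_fock"
  shows "(\<lambda>z. u z + v z) \<in> bargmann_fock"
proof -
  obtain f where f: "f holomorphic_on UNIV" "\<forall>z. u z = exp (- of_real ((cmod z)\<^sup>2 / 2)) * f z"
    "square_integrable u" using assms(1) by (rule bargmann_fockE)
  obtain g where g: "g holomorphic_on UNIV" "\<forall>z. v z = exp (- of_real ((cmod z)\<^sup>2 / 2)) * g z"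
    "square_integrable v" using assms(2) by (rule bargmann_fockE)
  show ?thesis
  proof (rule bargmann_fockI)
    show "(\<lambda>z. f z + g z) holomorphic_on UNIV" by (intro holomorphic_intros f(1) g(1))
    show "square_integrable (\<lambda>z. u z + v z)" by (intro square_integrable_add f(3) g(3))
  qed (use f(2) g(2) in \<open>simp add: distrib_left\<close>)
qed

lemma bargmann_fock_mult:
  assumes "u \<in> bargmann_fock"
  shows "(\<lambda>z. c * u z) \<in> bargmann_fock"
proof -
  obtain f where f: "f holomorphic_on UNIV" "\<forall>z. u z = exp (- of_real ((cmod z)\<^sup>2 / 2)) * f z"
    "square_integrable u" using assms(1) by (rule bargmann_fockE)
  show ?thesis
  proof (rule bargmann_fockI)
    show "(\<lambda>z. c * f z) holomorphic_on UNIV" by (intro holomorphic_intros f(1))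
    show "square_integrable (\<lambda>z. c * u z)" by (intro square_integrable_mult f(3))
  qed (use f(2) in simp)
qed

lemma L2_norm_nonneg: "0 \<le> L2_norm u"
  by (simp add: L2_norm_def)

lemma L2_norm_squared: "(L2_norm u)\<^sup>2 = (\<integral>z. (cmod (u z))\<^sup>2 \<partial>lborel)"
  by (simp add: L2_norm_def)

text \<open>
  The magnetic translation \<open>F\<close> below moves the point \<open>z\<close> to the origin while preserving both
  holomorphy and the \<open>L\<^sup>2\<close> norm, which reduces the claim to the evaluation at 0.
\<close>

lemma bargmann_fock_pointwise_bound:
  assumes "u \<in> bargmann_fock"
  shows "(cmod (u z))\<^sup>2 \<le> exp 1 / pi * (L2_norm u)\<^sup>2"
proof -
  obtain f where f: "f holomorphic_on UNIV" "\<forall>z. u z = exp (- of_real ((cmod z)\<^sup>2 / 2)) * f z"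
    "square_integrable u" using assms(1) by (rule bargmann_fockE)
  have [measurable]: "u \<in> borel_measurable borel" and ui: "integrable lborel (\<lambda>w. (cmod (u w))\<^sup>2)"
    using f(3) by (auto simp: square_integrable_def)
  define F where "F w = f (z + w) * exp (- cnj z * w - of_real ((cmod z)\<^sup>2 / 2))" for w
  have hol: "F holomorphic_on UNIV"
    unfolding F_def
    by (intro holomorphic_intros holomorphic_on_compose_gen[OF _ f(1), unfolded o_def]) auto
  have eq: "(cmod (F w))\<^sup>2 * exp (- (cmod w)\<^sup>2) = (cmod (u (z + w)))\<^sup>2" for w
  proof -
    have "(cmod (z + w))\<^sup>2 = (cmod z)\<^sup>2 + (cmod w)\<^sup>2 + 2 * Re (cnj z * w)"
      by (simp add: cmod_power2 power2_sum algebra_simps)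
    then show ?thesis
      by (simp add: F_def f(2) norm_mult power_mult_distrib norm_exp flip: exp_double exp_add)
         (simp add: algebra_simps)
  qed
  have "(cmod (F 0))\<^sup>2 \<le> exp 1 / pi * (\<integral>w. (cmod (F w))\<^sup>2 * exp (- (cmod w)\<^sup>2) \<partial>lborel)"
    by (rule gaussian_evaluation_bound[OF hol]) (unfold eq, rule integrable_translate[OF ui])
  also have "(\<integral>w. (cmod (F w))\<^sup>2 * exp (- (cmod w)\<^sup>2) \<partial>lborel) = (L2_norm u)\<^sup>2"
    unfolding eq L2_norm_squared by (rule integral_translate) measurable
  also have "(cmod (F 0))\<^sup>2 = (cmod (u z))\<^sup>2" using eq[of 0] by simp
  finally show ?thesis .
qed

section \<open>The Bargmann-Fock space as an inner product space\<close>

lemma bargmann_fock_zero: "(\<lambda>z. 0) \<in> bargmann_fock"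
  by (rule bargmann_fockI[of "\<lambda>_. 0"]) (auto simp: square_integrable_def)

text \<open>
  By the pointwise bound the \<open>L\<^sup>2\<close> norm of a genuine function in the Bargmann-Fock space vanishes
  only for the zero function, so the space can be made an instance of \<^class>\<open>real_inner\<close> without
  forming a quotient. This turns the \<open>L\<^sup>2\<close> derivatives into ordinary vector derivatives, and makes
  the pair of unknowns an element of a product of inner product spaces.
\<close>

typedef fock = bargmann_fock
  using bargmann_fock_zero by blast

setup_lifting type_definition_fock

lemma square_integrable_inner:
  assumes "square_integrable u" "square_integrable v"
  shows "integrable lborel (\<lambda>z. u z \<bullet> v z)"
proof -
  have [measurable]: "u \<in> borel_measurable lborel" "v \<in> borel_measurable lborel"
    using assms by (auto simp: square_integrable_def)
  have i: "integrable lborel (\<lambda>z. (cmod (u z))\<^sup>2 + (cmod (v z))\<^sup>2)"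
    using assms by (auto simp: square_integrable_def)
  show ?thesis
  proof (rule Bochner_Integration.integrable_bound[OF i], measurable, intro AE_I2)
    fix z
    have "\<bar>u z \<bullet> v z\<bar> \<le> cmod (u z) * cmod (v z)"
      by (rule Cauchy_Schwarz_ineq2)
    also have "\<dots> \<le> (cmod (u z))\<^sup>2 + (cmod (v z))\<^sup>2"
      using sum_squares_bound[of "cmod (u z)" "cmod (v z)"]
        mult_nonneg_nonneg[OF norm_ge_zero[of "u z"] norm_ge_zero[of "v z"]]
      unfolding mult.assoc by linarith
    finally show "norm (u z \<bullet> v z) \<le> norm ((cmod (u z))\<^sup>2 + (cmod (v z))\<^sup>2)" by simp
  qed
qed

instantiation fock :: real_inner
begin

lift_definition zero_fock :: fock is "\<lambda>z. 0" by (rule bargmann_fock_zero)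
lift_definition plus_fock :: "fock \<Rightarrow> fock \<Rightarrow> fock" is "\<lambda>u v z. u z + v z"
  by (rule bargmann_fock_add)
lift_definition uminus_fock :: "fock \<Rightarrow> fock" is "\<lambda>u z. - u z"
  using bargmann_fock_mult[of _ "-1"] by simp
lift_definition minus_fock :: "fock \<Rightarrow> fock \<Rightarrow> fock" is "\<lambda>u v z. u z - v z"
  using bargmann_fock_add[OF _ bargmann_fock_mult[of _ "-1"]] by simp
lift_definition scaleR_fock :: "real \<Rightarrow> fock \<Rightarrow> fock" is "\<lambda>r u z. of_real r * u z"
  by (rule bargmann_fock_mult)
lift_definition inner_fock :: "fock \<Rightarrow> fock \<Rightarrow> real" is "\<lambda>u v. \<integral>z. u z \<bullet> v z \<partial>lborel" .
lift_definition norm_fock :: "fock \<Rightarrow> real" is L2_norm .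

definition dist_fock :: "fock \<Rightarrow> fock \<Rightarrow> real" where "dist_fock u v = norm (u - v)"
definition sgn_fock :: "fock \<Rightarrow> fock" where "sgn_fock u = inverse (norm u) *\<^sub>R u"
definition uniformity_fock :: "(fock \<times> fock) filter" where
  "uniformity_fock = (INF e\<in>{0<..}. principal {(x, y). dist x y < e})"
definition open_fock :: "fock set \<Rightarrow> bool" where
  "open_fock U \<longleftrightarrow> (\<forall>x\<in>U. \<forall>\<^sub>F (x', y) in uniformity. x' = x \<longrightarrow> y \<in> U)"

instance
proof
  fix x y z :: fock and r s :: real
  show "dist x y = norm (x - y)" by (rule dist_fock_def)
  show "sgn x = inverse (norm x) *\<^sub>R x" by (rule sgn_fock_def)
  show "(uniformity :: (fock \<times> fock) filter) = (INF e\<in>{0<..}. principal {(x, y). dist x y < e})"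
    by (rule uniformity_fock_def)
  show "open U \<longleftrightarrow> (\<forall>x\<in>U. \<forall>\<^sub>F (x', y) in uniformity. x' = x \<longrightarrow> y \<in> U)" for U :: "fock set"
    by (rule open_fock_def)
  show "x + y + z = x + (y + z)" "x + y = y + x" "0 + x = x" "- x + x = 0" "x - y = x + - y"
    by (transfer; simp add: fun_eq_iff)+
  show "r *\<^sub>R (x + y) = r *\<^sub>R x + r *\<^sub>R y" "(r + s) *\<^sub>R x = r *\<^sub>R x + s *\<^sub>R x"
    "r *\<^sub>R s *\<^sub>R x = (r * s) *\<^sub>R x" "1 *\<^sub>R x = x"
    by (transfer; simp add: fun_eq_iff algebra_simps)+
  show "x \<bullet> y = y \<bullet> x" by transfer (simp add: inner_commute)
  show "(x + y) \<bullet> z = x \<bullet> z + y \<bullet> z"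
    by transfer (simp add: inner_add_left square_integrable_inner bargmann_fock_square_integrable)
  show "r *\<^sub>R x \<bullet> y = r * (x \<bullet> y)"
    by transfer (simp flip: scaleR_conv_of_real)
  show ge: "0 \<le> x \<bullet> x" by transfer (simp add: power2_norm_eq_inner[symmetric])
  show nrm: "norm x = sqrt (x \<bullet> x)" by transfer (simp add: L2_norm_def power2_norm_eq_inner)
  show "x \<bullet> x = 0 \<longleftrightarrow> x = 0"
  proof
    assume "x \<bullet> x = 0"
    with nrm have "norm x = 0" by simp
    then show "x = 0"
    proof transfer
      fix u assume u: "u \<in> bargmann_fock" "L2_norm u = 0"
      have "(cmod (u z))\<^sup>2 \<le> 0" for z
        using bargmann_fock_pointwise_bound[OF u(1), of z] u(2) by simp
      then show "u = (\<lambda>z. 0)" by (simp add: fun_eq_iff)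
    qed
  qed (transfer, simp)
qed

end

text \<open>
  The bridge from the \<open>L\<^sup>2\<close> derivatives of the system to the calculus of curves in \<^typ>\<open>fock\<close>.
\<close>

lemma has_vector_derivative_Abs_fock:
  assumes u: "\<And>s. u s \<in> bargmann_fock" and w: "w \<in> bargmann_fock"
    and d: "has_L2_derivative u w t"
  shows "((\<lambda>s. Abs_fock (u s)) has_vector_derivative Abs_fock w) (at t)"
proof -
  have rep: "Rep_fock (Abs_fock (u s)) = u s" "Rep_fock (Abs_fock w) = w" for s
    using u w by (simp_all add: Abs_fock_inverse)
  have eq: "norm ((Abs_fock (u (t + h)) - Abs_fock (u t)) /\<^sub>R h - Abs_fock w)
      = L2_norm (\<lambda>z. (u (t + h) z - u t z) / of_real h - w z)" for h
    by (simp add: norm_fock.rep_eq minus_fock.rep_eq scaleR_fock.rep_eq rep divide_inverse mult.commute)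
  have quot: "norm (Abs_fock (u (t + h)) - Abs_fock (u t) - h *\<^sub>R Abs_fock w) / norm h
      = L2_norm (\<lambda>z. (u (t + h) z - u t z) / of_real h - w z)" if "h \<noteq> 0" for h
  proof -
    have "Abs_fock (u (t + h)) - Abs_fock (u t) - h *\<^sub>R Abs_fock w
        = h *\<^sub>R ((Abs_fock (u (t + h)) - Abs_fock (u t)) /\<^sub>R h - Abs_fock w)"
      using that by (simp add: scaleR_diff_right)
    then show ?thesis using that by (simp add: eq)
  qed
  have "(\<lambda>h. norm (Abs_fock (u (t + h)) - Abs_fock (u t) - h *\<^sub>R Abs_fock w) / norm h) \<midarrow>0\<rightarrow> 0"
    using d unfolding has_L2_derivative_def by (subst LIM_equal) (use quot in auto)
  then show ?thesis
    unfolding has_vector_derivative_def has_derivative_at by (simp add: bounded_linear_scaleR_left)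
qed

text \<open>
  The function \<open>|x s|\<^sup>2 exp(-2 C s)\<close> has nonpositive derivative, and it vanishes at time 0.
\<close>

lemma gronwall_zero_forward:
  fixes x :: "real \<Rightarrow> 'a::real_inner"
  assumes d: "\<And>s. s \<in> {0..T} \<Longrightarrow> (x has_vector_derivative x' s) (at s)"
    and le: "\<And>s. s \<in> {0..T} \<Longrightarrow> norm (x' s) \<le> C * norm (x s)"
    and x0: "x 0 = 0" and T: "T \<ge> 0"
  shows "x T = 0"
proof -
  define g where "g s = (x s \<bullet> x s) * exp (- 2 * C * s)" for s
  have "g T \<le> g 0"
  proof (rule DERIV_nonpos_imp_nonincreasing[OF T])
    fix s assume s: "0 \<le> s" "s \<le> T"
    have "((\<lambda>s. x s \<bullet> x s) has_vector_derivative (x s \<bullet> x' s + x' s \<bullet> x s)) (at s)"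
      by (rule bounded_bilinear.has_vector_derivative[OF bounded_bilinear_inner]) (use d s in auto)
    then have "((\<lambda>s. x s \<bullet> x s) has_real_derivative (2 * (x s \<bullet> x' s))) (at s)"
      by (simp add: has_real_derivative_iff_has_vector_derivative inner_commute)
    then have 1: "(g has_real_derivative (2 * (x s \<bullet> x' s) * exp (- 2 * C * s)
        + (x s \<bullet> x s) * (exp (- 2 * C * s) * (- 2 * C)))) (at s)"
      unfolding g_def by (auto intro!: derivative_eq_intros)
    have "x s \<bullet> x' s \<le> norm (x s) * norm (x' s)" by (rule norm_cauchy_schwarz)
    also have "\<dots> \<le> norm (x s) * (C * norm (x s))"
      using le s by (intro mult_left_mono) auto
    also have "\<dots> = C * (x s \<bullet> x s)" by (simp add: dot_square_norm power2_eq_square)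
    finally have "(2 * (x s \<bullet> x' s) - 2 * C * (x s \<bullet> x s)) * exp (- 2 * C * s) \<le> 0"
      by (intro mult_nonpos_nonneg) auto
    then have "2 * (x s \<bullet> x' s) * exp (- 2 * C * s) + (x s \<bullet> x s) * (exp (- 2 * C * s) * (- 2 * C)) \<le> 0"
      by (simp add: algebra_simps)
    with 1 show "\<exists>y. (g has_real_derivative y) (at s) \<and> y \<le> 0" by blast
  qed
  then have "x T \<bullet> x T \<le> 0" by (simp add: g_def x0 mult_le_0_iff)
  then show ?thesis by (metis inner_eq_zero_iff inner_ge_zero order_antisym)
qed

lemma gronwall_zero:
  fixes x :: "real \<Rightarrow> 'a::real_inner"
  assumes d: "\<And>s. (x has_vector_derivative x' s) (at s)"
    and le: "\<And>s. \<bar>s\<bar> \<le> \<bar>T\<bar> \<Longrightarrow> norm (x' s) \<le> C * norm (x s)"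
    and x0: "x 0 = 0"
  shows "x T = 0"
proof (cases "T \<ge> 0")
  case True
  then show ?thesis by (intro gronwall_zero_forward[OF d _ x0]) (auto intro: le)
next
  case False
  have "((\<lambda>s. x (- s)) has_vector_derivative - x' (- s)) (at s)" for s
    using vector_diff_chain_at[OF has_vector_derivative_minus[OF has_vector_derivative_id], of x "x' (- s)" s]
      d[of "- s"] by (simp add: o_def)
  then have "(\<lambda>s. x (- s)) (- T) = 0"
    by (rule gronwall_zero_forward[where C = C]) (use False x0 le in auto)
  then show ?thesis by simp
qed

section \<open>The projection is bounded on the space of square integrable functions\<close>

lemma norm_fock_kernel:
  "exp (- (cmod z)\<^sup>2 / 2) * cmod (exp (cnj w * z - of_real ((cmod w)\<^sup>2 / 2))) = exp (- (cmod (z - w))\<^sup>2 / 2)"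
proof -
  have "(cmod (z - w))\<^sup>2 = (cmod z)\<^sup>2 + (cmod w)\<^sup>2 - 2 * Re (cnj w * z)"
    by (simp add: cmod_power2 power2_diff algebra_simps)
  then show ?thesis by (simp add: norm_exp field_simps flip: exp_add)
qed

lemma gaussian_integral_translated:
  "integrable lborel (\<lambda>w. exp (- (cmod (z - w))\<^sup>2 / 2))"
  "(\<integral>w. exp (- (cmod (z - w))\<^sup>2 / 2) \<partial>lborel) = 2 * pi"
proof -
  have h: "has_bochner_integral lborel (\<lambda>w::complex. exp (- (cmod w)\<^sup>2 / 2)) (2 * pi)"
    using has_bochner_integral_gaussian_moment[of "1/2" 0] by (simp add: mult.commute)
  have eq: "exp (- (cmod (z - w))\<^sup>2 / 2) = exp (- (cmod (- z + w))\<^sup>2 / 2)" for w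
    by (metis minus_diff_eq norm_minus_cancel uminus_add_conv_diff)
  show "integrable lborel (\<lambda>w. exp (- (cmod (z - w))\<^sup>2 / 2))"
    unfolding eq by (rule integrable_translate) (use h in \<open>simp add: has_bochner_integral_iff\<close>)
  show "(\<integral>w. exp (- (cmod (z - w))\<^sup>2 / 2) \<partial>lborel) = 2 * pi"
    unfolding eq by (subst integral_translate) (use h in \<open>auto simp: has_bochner_integral_iff\<close>)
qed

lemma nn_integral_gaussian_translated:
  "(\<integral>\<^sup>+w. ennreal (exp (- (cmod (z - w))\<^sup>2 / 2)) \<partial>lborel) = ennreal (2 * pi)"
  using gaussian_integral_translated[of z] by (subst nn_integral_eq_integral) auto

lemma integrable_fock_kernel:
  assumes F: "square_integrable F"
  shows "integrable lborel (\<lambda>w. exp (cnj w * z - of_real ((cmod w)\<^sup>2 / 2)) * F w)"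
proof -
  have [measurable]: "F \<in> borel_measurable borel" and Fi: "integrable lborel (\<lambda>w. (cmod (F w))\<^sup>2)"
    using F by (auto simp: square_integrable_def)
  have i: "integrable lborel (\<lambda>w. exp ((cmod z)\<^sup>2 / 2) * (exp (- (cmod (z - w))\<^sup>2 / 2) + (cmod (F w))\<^sup>2))"
    by (intro integrable_mult_right Bochner_Integration.integrable_add Fi gaussian_integral_translated)
  show ?thesis
  proof (rule Bochner_Integration.integrable_bound[OF i], measurable, intro AE_I2)
    fix w
    define e where "e = exp (- (cmod (z - w))\<^sup>2 / 2)"
    have e: "0 < e" "e \<le> 1" by (auto simp: e_def)
    have "e * cmod (F w) \<le> e + (cmod (F w))\<^sup>2"
    proof (cases "cmod (F w) \<le> 1")
      case True
      then have "e * cmod (F w) \<le> e * 1" using e by (intro mult_left_mono) auto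
      then show ?thesis by (smt (verit) mult.right_neutral zero_le_power2)
    next
      case False
      then have "e * cmod (F w) \<le> cmod (F w) * cmod (F w)" using e by (intro mult_right_mono) auto
      then show ?thesis using e by (simp add: power2_eq_square)
    qed
    moreover have "cmod (exp (cnj w * z - of_real ((cmod w)\<^sup>2 / 2))) = exp ((cmod z)\<^sup>2 / 2) * e"
      unfolding e_def norm_fock_kernel[symmetric] by (simp flip: exp_add mult.assoc)
    ultimately show "norm (exp (cnj w * z - of_real ((cmod w)\<^sup>2 / 2)) * F w)
        \<le> norm (exp ((cmod z)\<^sup>2 / 2) * (exp (- (cmod (z - w))\<^sup>2 / 2) + (cmod (F w))\<^sup>2))"
      using e unfolding norm_mult e_def[symmetric] by (simp add: mult.assoc abs_of_nonneg)
  qed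
qed

lemma bf_proj_diff:
  assumes "square_integrable F" "square_integrable G"
  shows "bf_proj F z - bf_proj G z = bf_proj (\<lambda>w. F w - G w) z"
  unfolding bf_proj_def right_diff_distrib[symmetric]
  by (subst Bochner_Integration.integral_diff[symmetric])
     (simp_all add: assms integrable_fock_kernel right_diff_distrib del: of_real_divide of_real_power)

text \<open>
  First half of the Schur test: the kernel has modulus \<open>exp(-|z - w|\<^sup>2/2) / \<pi>\<close>, of total mass 2, and
  the Cauchy-Schwarz inequality is applied with the square root of the kernel split off.
\<close>

lemma bf_proj_pointwise:
  assumes F: "square_integrable F"
  shows "ennreal ((cmod (bf_proj F z))\<^sup>2)
     \<le> ennreal (2 / pi) * (\<integral>\<^sup>+w. ennreal (exp (- (cmod (z - w))\<^sup>2 / 2)) * ennreal ((cmod (F w))\<^sup>2) \<partial>lborel)"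
proof -
  have [measurable]: "F \<in> borel_measurable borel"
    using F by (auto simp: square_integrable_def)
  let ?k = "\<lambda>w. exp (cnj w * z - of_real ((cmod w)\<^sup>2 / 2))"
  let ?e = "\<lambda>w. exp (- (cmod (z - w))\<^sup>2 / 4)"
  have ee: "exp (- (cmod (z - w))\<^sup>2 / 2) = (?e w)\<^sup>2" for w
    by (simp flip: exp_double) 
  have "cmod (bf_proj F z) = exp (- (cmod z)\<^sup>2 / 2) / pi * norm (\<integral>w. ?k w * F w \<partial>lborel)"
    by (simp add: bf_proj_def norm_mult norm_divide norm_exp)
  then have "ennreal (cmod (bf_proj F z)) = ennreal (exp (- (cmod z)\<^sup>2 / 2) / pi) * ennreal (norm (\<integral>w. ?k w * F w \<partial>lborel))"
    by (simp only:, intro ennreal_mult) auto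
  also have "\<dots> \<le> ennreal (exp (- (cmod z)\<^sup>2 / 2) / pi) * (\<integral>\<^sup>+w. ennreal (norm (?k w * F w)) \<partial>lborel)"
    by (intro mult_left_mono integral_norm_bound_ennreal integrable_fock_kernel F) auto
  also have "\<dots> = (\<integral>\<^sup>+w. ennreal (exp (- (cmod z)\<^sup>2 / 2) / pi) * ennreal (norm (?k w * F w)) \<partial>lborel)"
    by (rule nn_integral_cmult[symmetric]) measurable
  also have "\<dots> = (\<integral>\<^sup>+w. ennreal (1 / pi) * (ennreal (?e w) * ennreal (?e w * cmod (F w))) \<partial>lborel)"
  proof (intro nn_integral_cong)
    fix w
    have "exp (- (cmod z)\<^sup>2 / 2) / pi * norm (?k w * F w) = 1 / pi * (?e w * (?e w * cmod (F w)))"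
      using norm_fock_kernel[of z w] unfolding ee by (simp add: norm_mult power2_eq_square field_simps)
    then show "ennreal (exp (- (cmod z)\<^sup>2 / 2) / pi) * ennreal (norm (?k w * F w))
       = ennreal (1 / pi) * (ennreal (?e w) * ennreal (?e w * cmod (F w)))"
      by (simp flip: ennreal_mult)
  qed
  also have "\<dots> = ennreal (1 / pi) * (\<integral>\<^sup>+w. ennreal (?e w) * ennreal (?e w * cmod (F w)) \<partial>lborel)"
    by (rule nn_integral_cmult) measurable
  finally have 1: "ennreal (cmod (bf_proj F z)) \<le> \<dots>" .
  have "ennreal ((cmod (bf_proj F z))\<^sup>2) = (ennreal (cmod (bf_proj F z)))\<^sup>2"
    by (simp add: ennreal_power)
  also have "\<dots> \<le> (ennreal (1 / pi) * (\<integral>\<^sup>+w. ennreal (?e w) * ennreal (?e w * cmod (F w)) \<partial>lborel))\<^sup>2"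
    using 1 by (rule power_mono) auto
  also have "\<dots> = ennreal ((1 / pi)\<^sup>2) * (\<integral>\<^sup>+w. ennreal (?e w) * ennreal (?e w * cmod (F w)) \<partial>lborel)\<^sup>2"
    by (simp add: power_mult_distrib ennreal_power)
  also have "\<dots> \<le> ennreal ((1 / pi)\<^sup>2) * ((\<integral>\<^sup>+w. (ennreal (?e w))\<^sup>2 \<partial>lborel) * (\<integral>\<^sup>+w. (ennreal (?e w * cmod (F w)))\<^sup>2 \<partial>lborel))"
    by (intro mult_left_mono Cauchy_Schwarz_nn_integral) auto
  also have "(\<integral>\<^sup>+w. (ennreal (?e w))\<^sup>2 \<partial>lborel) = ennreal (2 * pi)"
    using nn_integral_gaussian_translated[of z] unfolding ee by (simp add: ennreal_power)
  also have "(\<integral>\<^sup>+w. (ennreal (?e w * cmod (F w)))\<^sup>2 \<partial>lborel)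
      = (\<integral>\<^sup>+w. ennreal (exp (- (cmod (z - w))\<^sup>2 / 2)) * ennreal ((cmod (F w))\<^sup>2) \<partial>lborel)"
    unfolding ee by (simp add: ennreal_power power_mult_distrib flip: ennreal_mult)
  also have "ennreal ((1 / pi)\<^sup>2) * (ennreal (2 * pi) * x) = ennreal (2 / pi) * x" for x
    by (simp flip: ennreal_mult mult.assoc) (simp add: power2_eq_square)
  finally show ?thesis .
qed

text \<open>
  Second half of the Schur test: integrating the pointwise estimate in \<open>z\<close> first. The sharp constant
  is 1, but any constant serves for uniqueness.
\<close>

lemma bf_proj_L2_bound:
  assumes F: "square_integrable F"
  shows "L2_norm (bf_proj F) \<le> 2 * L2_norm F"
proof (cases "integrable lborel (\<lambda>z. (cmod (bf_proj F z))\<^sup>2)")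
  case False
  then have "L2_norm (bf_proj F) = 0" by (simp add: L2_norm_def not_integrable_integral_eq)
  then show ?thesis using L2_norm_nonneg by simp
next
  case True
  have [measurable]: "F \<in> borel_measurable borel" and Fi: "integrable lborel (\<lambda>w. (cmod (F w))\<^sup>2)"
    using F by (auto simp: square_integrable_def)
  have cm: "(\<lambda>(z, w). ennreal (exp (- (cmod (z - w))\<^sup>2 / 2)) * ennreal ((cmod (F w))\<^sup>2))
     \<in> borel_measurable (lborel \<Otimes>\<^sub>M lborel)"
    by measurable
  have "ennreal ((L2_norm (bf_proj F))\<^sup>2) = (\<integral>\<^sup>+z. ennreal ((cmod (bf_proj F z))\<^sup>2) \<partial>lborel)"
    unfolding L2_norm_squared using True by (subst nn_integral_eq_integral) auto
  also have "\<dots> \<le> (\<integral>\<^sup>+z. ennreal (2 / pi) * (\<integral>\<^sup>+w. ennreal (exp (- (cmod (z - w))\<^sup>2 / 2)) * ennreal ((cmod (F w))\<^sup>2) \<partial>lborel) \<partial>lborel)"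
    by (intro nn_integral_mono bf_proj_pointwise F)
  also have "\<dots> = ennreal (2 / pi) * (\<integral>\<^sup>+z. \<integral>\<^sup>+w. ennreal (exp (- (cmod (z - w))\<^sup>2 / 2)) * ennreal ((cmod (F w))\<^sup>2) \<partial>lborel \<partial>lborel)"
    by (rule nn_integral_cmult) measurable
  also have "(\<integral>\<^sup>+z. \<integral>\<^sup>+w. ennreal (exp (- (cmod (z - w))\<^sup>2 / 2)) * ennreal ((cmod (F w))\<^sup>2) \<partial>lborel \<partial>lborel)
     = (\<integral>\<^sup>+w. \<integral>\<^sup>+z. ennreal (exp (- (cmod (z - w))\<^sup>2 / 2)) * ennreal ((cmod (F w))\<^sup>2) \<partial>lborel \<partial>lborel)"
    by (rule lborel_pair.Fubini'[OF cm, symmetric])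
  also have "\<dots> = (\<integral>\<^sup>+w. ennreal (2 * pi) * ennreal ((cmod (F w))\<^sup>2) \<partial>lborel)"
  proof (intro nn_integral_cong)
    fix w
    have "(\<integral>\<^sup>+z. ennreal (exp (- (cmod (z - w))\<^sup>2 / 2)) * ennreal ((cmod (F w))\<^sup>2) \<partial>lborel)
        = (\<integral>\<^sup>+z. ennreal (exp (- (cmod (z - w))\<^sup>2 / 2)) \<partial>lborel) * ennreal ((cmod (F w))\<^sup>2)"
      by (rule nn_integral_multc) measurable
    also have "(\<integral>\<^sup>+z. ennreal (exp (- (cmod (z - w))\<^sup>2 / 2)) \<partial>lborel) = ennreal (2 * pi)"
      using nn_integral_gaussian_translated[of w] by (simp add: norm_minus_commute)
    finally show "(\<integral>\<^sup>+z. ennreal (exp (- (cmod (z - w))\<^sup>2 / 2)) * ennreal ((cmod (F w))\<^sup>2) \<partial>lborel)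
        = ennreal (2 * pi) * ennreal ((cmod (F w))\<^sup>2)" .
  qed
  also have "\<dots> = ennreal (2 * pi) * ennreal ((L2_norm F)\<^sup>2)"
    unfolding L2_norm_squared using Fi by (subst nn_integral_cmult) (auto simp: nn_integral_eq_integral)
  also have "ennreal (2 / pi) * (ennreal (2 * pi) * ennreal ((L2_norm F)\<^sup>2)) = ennreal ((2 * L2_norm F)\<^sup>2)"
  proof -
    have "ennreal (2 / pi * (2 * pi * (L2_norm F)\<^sup>2)) = ennreal (2 / pi) * (ennreal (2 * pi) * ennreal ((L2_norm F)\<^sup>2))"
      by (subst ennreal_mult, simp, simp, subst ennreal_mult) simp_all
    moreover have "2 / pi * (2 * pi * (L2_norm F)\<^sup>2) = (2 * L2_norm F)\<^sup>2"
      by (simp add: power_mult_distrib)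
    ultimately show ?thesis by simp
  qed
  finally have "(L2_norm (bf_proj F))\<^sup>2 \<le> (2 * L2_norm F)\<^sup>2"
    by (simp only: ennreal_le_iff zero_le_power2)
  moreover have "0 \<le> 2 * L2_norm F" using L2_norm_nonneg[of F] by linarith
  ultimately show ?thesis by (rule power2_le_imp_le)
qed

section \<open>Uniqueness of solutions\<close>

lemma square_integrable_cubic:
  assumes u: "u \<in> bargmann_fock" and v: "v \<in> bargmann_fock"
  shows "square_integrable (\<lambda>w. of_real ((cmod (v w))\<^sup>2) * u w)"
proof -
  have [measurable]: "u \<in> borel_measurable borel" "v \<in> borel_measurable borel"
    and ui: "integrable lborel (\<lambda>w. (cmod (u w))\<^sup>2)"
    using u v by (auto dest!: bargmann_fock_square_integrable simp: square_integrable_def)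
  define B where "B = exp 1 / pi * (L2_norm v)\<^sup>2"
  have "integrable lborel (\<lambda>w. B\<^sup>2 * (cmod (u w))\<^sup>2)"
    by (intro integrable_mult_right ui)
  then have "integrable lborel (\<lambda>w. (cmod (of_real ((cmod (v w))\<^sup>2) * u w))\<^sup>2)"
  proof (rule Bochner_Integration.integrable_bound, measurable, intro AE_I2)
    fix w
    have "((cmod (v w))\<^sup>2)\<^sup>2 \<le> B\<^sup>2"
      unfolding B_def by (intro power_mono bargmann_fock_pointwise_bound v) auto
    then have "((cmod (v w))\<^sup>2)\<^sup>2 * (cmod (u w))\<^sup>2 \<le> B\<^sup>2 * (cmod (u w))\<^sup>2"
      by (intro mult_right_mono) auto
    then show "norm ((cmod (of_real ((cmod (v w))\<^sup>2) * u w))\<^sup>2) \<le> norm (B\<^sup>2 * (cmod (u w))\<^sup>2)"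
      by (simp add: norm_mult norm_power power_mult_distrib)
  qed
  then show ?thesis by (simp add: square_integrable_def)
qed

text \<open>
  Pointwise Lipschitz estimate for the cubic term, from
  \<open>|a|\<^sup>2 c - |b|\<^sup>2 d = |a|\<^sup>2 (c - d) + (|a| - |b|) (|a| + |b|) d\<close>.
\<close>

lemma cubic_difference_bound:
  fixes a b c d :: complex
  assumes "(cmod a)\<^sup>2 \<le> B" "(cmod b)\<^sup>2 \<le> B" "(cmod d)\<^sup>2 \<le> B"
  shows "(cmod (of_real ((cmod a)\<^sup>2) * c - of_real ((cmod b)\<^sup>2) * d))\<^sup>2
    \<le> 8 * B\<^sup>2 * ((cmod (c - d))\<^sup>2 + (cmod (a - b))\<^sup>2)"
proof -
  define S where "S = sqrt B"
  have B0: "0 \<le> B" using assms(1) by (meson order_trans zero_le_power2)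
  have S: "cmod a \<le> S" "cmod b \<le> S" "cmod d \<le> S" "0 \<le> S" "S * S = B"
    using assms B0 by (auto simp: S_def real_le_rsqrt)
  have "\<bar>(cmod a)\<^sup>2 - (cmod b)\<^sup>2\<bar> = \<bar>cmod a - cmod b\<bar> * (cmod a + cmod b)"
    by (simp add: power2_eq_square square_diff_square_factored abs_mult)
  also have "\<dots> \<le> cmod (a - b) * (S + S)"
    by (intro mult_mono norm_triangle_ineq3 add_mono S) auto
  finally have ab: "\<bar>(cmod a)\<^sup>2 - (cmod b)\<^sup>2\<bar> \<le> cmod (a - b) * (S + S)" .
  have "cmod (of_real ((cmod a)\<^sup>2) * c - of_real ((cmod b)\<^sup>2) * d)
      = cmod (of_real ((cmod a)\<^sup>2) * (c - d) + of_real ((cmod a)\<^sup>2 - (cmod b)\<^sup>2) * d)"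
    by (simp add: algebra_simps)
  also have "\<dots> \<le> (cmod a)\<^sup>2 * cmod (c - d) + \<bar>(cmod a)\<^sup>2 - (cmod b)\<^sup>2\<bar> * cmod d"
    by (rule order_trans[OF norm_triangle_ineq]) (simp add: norm_mult flip: of_real_power of_real_diff)
  also have "\<dots> \<le> B * cmod (c - d) + cmod (a - b) * (S + S) * S"
    by (intro add_mono mult_mono ab assms S) (use S in auto)
  also have "\<dots> = B * (cmod (c - d) + 2 * cmod (a - b))"
    using S(5) by (simp add: algebra_simps)
  finally have "(cmod (of_real ((cmod a)\<^sup>2) * c - of_real ((cmod b)\<^sup>2) * d))\<^sup>2
     \<le> (B * (cmod (c - d) + 2 * cmod (a - b)))\<^sup>2"
    by (intro power_mono) auto
  also have "\<dots> \<le> B\<^sup>2 * (8 * ((cmod (c - d))\<^sup>2 + (cmod (a - b))\<^sup>2))"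
  proof -
    have "(cmod (c - d) + 2 * cmod (a - b))\<^sup>2 \<le> 2 * (cmod (c - d))\<^sup>2 + 2 * (2 * cmod (a - b))\<^sup>2"
      using sum_squares_bound[of "cmod (c - d)" "2 * cmod (a - b)"] by (simp add: power2_sum)
    also have "\<dots> \<le> 8 * ((cmod (c - d))\<^sup>2 + (cmod (a - b))\<^sup>2)"
      by (simp add: power_mult_distrib)
    finally show ?thesis unfolding power_mult_distrib by (intro mult_left_mono) auto
  qed
  finally show ?thesis by (simp add: algebra_simps)
qed

lemma bf_proj_cubic_lipschitz:
  assumes "u1 \<in> bargmann_fock" "v1 \<in> bargmann_fock" "u2 \<in> bargmann_fock" "v2 \<in> bargmann_fock"
    and R: "L2_norm v1 \<le> R" "L2_norm u2 \<le> R" "L2_norm v2 \<le> R"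
  shows "(L2_norm (\<lambda>z. bf_proj (\<lambda>w. of_real ((cmod (v1 w))\<^sup>2) * u1 w) z - bf_proj (\<lambda>w. of_real ((cmod (v2 w))\<^sup>2) * u2 w) z))\<^sup>2
     \<le> 32 * (exp 1 / pi * R\<^sup>2)\<^sup>2 * ((L2_norm (\<lambda>z. u1 z - u2 z))\<^sup>2 + (L2_norm (\<lambda>z. v1 z - v2 z))\<^sup>2)"
proof -
  define B where "B = exp 1 / pi * R\<^sup>2"
  let ?F = "\<lambda>w. of_real ((cmod (v1 w))\<^sup>2) * u1 w" and ?G = "\<lambda>w. of_real ((cmod (v2 w))\<^sup>2) * u2 w"
  have sF: "square_integrable ?F" "square_integrable ?G"
    by (intro square_integrable_cubic assms)+
  have pw: "(cmod (u w))\<^sup>2 \<le> B" if "u \<in> bargmann_fock" "L2_norm u \<le> R" for u w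
  proof -
    have "(L2_norm u)\<^sup>2 \<le> R\<^sup>2" using that L2_norm_nonneg by (intro power_mono) auto
    then have "exp 1 / pi * (L2_norm u)\<^sup>2 \<le> B"
      unfolding B_def by (intro mult_left_mono) auto
    then show ?thesis using bargmann_fock_pointwise_bound[OF that(1), of w] by linarith
  qed
  have diff: "square_integrable (\<lambda>z. u z - v z)" if "square_integrable u" "square_integrable v" for u v
    using square_integrable_add[OF that(1) square_integrable_mult[OF that(2), of "-1"]] by simp
  have si: "square_integrable u1" "square_integrable u2" "square_integrable v1" "square_integrable v2"
    using assms by (auto intro: bargmann_fock_square_integrable)
  have "(L2_norm (\<lambda>z. bf_proj ?F z - bf_proj ?G z))\<^sup>2 = (L2_norm (bf_proj (\<lambda>w. ?F w - ?G w)))\<^sup>2"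
    by (simp only: bf_proj_diff[OF sF])
  also have "\<dots> \<le> (2 * L2_norm (\<lambda>w. ?F w - ?G w))\<^sup>2"
    by (intro power_mono bf_proj_L2_bound diff sF L2_norm_nonneg)
  also have "\<dots> = 4 * (\<integral>w. (cmod (?F w - ?G w))\<^sup>2 \<partial>lborel)"
    by (simp only: power_mult_distrib L2_norm_squared) simp
  also have "(\<integral>w. (cmod (?F w - ?G w))\<^sup>2 \<partial>lborel)
     \<le> (\<integral>w. 8 * B\<^sup>2 * ((cmod (u1 w - u2 w))\<^sup>2 + (cmod (v1 w - v2 w))\<^sup>2) \<partial>lborel)"
  proof (rule integral_mono)
    show "integrable lborel (\<lambda>w. (cmod (?F w - ?G w))\<^sup>2)"
      using diff[OF sF] by (simp add: square_integrable_def)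
    show "integrable lborel (\<lambda>w. 8 * B\<^sup>2 * ((cmod (u1 w - u2 w))\<^sup>2 + (cmod (v1 w - v2 w))\<^sup>2))"
      using diff[OF si(1,2)] diff[OF si(3,4)] unfolding square_integrable_def
      by (intro integrable_mult_right Bochner_Integration.integrable_add) auto
  qed (intro cubic_difference_bound pw assms)
  also have "\<dots> = 8 * B\<^sup>2 * ((L2_norm (\<lambda>z. u1 z - u2 z))\<^sup>2 + (L2_norm (\<lambda>z. v1 z - v2 z))\<^sup>2)"
    using diff[OF si(1,2)] diff[OF si(3,4)] unfolding square_integrable_def L2_norm_squared
    by simp
  finally show ?thesis by (simp add: B_def)
qed

text \<open>
  What uniqueness requires of a solution: one \<open>L\<^sup>2\<close> derivative at each time and the equations, without
  the derivatives of higher order. Only this much has to be verified for the explicit wave.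
\<close>

definition fock_flow :: "(real \<Rightarrow> complex \<Rightarrow> complex) \<Rightarrow> (real \<Rightarrow> complex \<Rightarrow> complex) \<Rightarrow> bool" where
  "fock_flow u v \<longleftrightarrow> (\<forall>t. u t \<in> bargmann_fock \<and> v t \<in> bargmann_fock \<and>
     (\<exists>ut\<in>bargmann_fock. \<exists>vt\<in>bargmann_fock.
        has_L2_derivative u ut t \<and> has_L2_derivative v vt t \<and>
        (\<forall>z. \<i> * ut z = bf_proj (\<lambda>w. of_real ((cmod (v t w))\<^sup>2) * u t w) z) \<and>
        (\<forall>z. \<i> * vt z = - bf_proj (\<lambda>w. of_real ((cmod (u t w))\<^sup>2) * v t w) z)))"

lemma is_solution_imp_fock_flow: "is_solution u v U V \<Longrightarrow> fock_flow u v"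
  unfolding is_solution_def fock_flow_def smooth_bf_curve_def by metis

text \<open>
  The difference of two solutions is a curve in \<open>fock \<times> fock\<close>. On a bounded time interval both
  solutions have bounded norm, so the Lipschitz estimate bounds the derivative of the difference by a
  multiple of the difference itself.
\<close>

lemma fock_flow_unique:
  assumes f1: "fock_flow u1 v1" and f2: "fock_flow u2 v2"
    and init: "u1 0 = u2 0" "v1 0 = v2 0"
  shows "u1 T = u2 T \<and> v1 T = v2 T"
proof -
  have bf: "u1 s \<in> bargmann_fock" "v1 s \<in> bargmann_fock" "u2 s \<in> bargmann_fock" "v2 s \<in> bargmann_fock" for s
    using f1 f2 by (auto simp: fock_flow_def)
  obtain ut1 vt1 where d1: "\<And>t. ut1 t \<in> bargmann_fock" "\<And>t. vt1 t \<in> bargmann_fock"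
      "\<And>t. has_L2_derivative u1 (ut1 t) t" "\<And>t. has_L2_derivative v1 (vt1 t) t"
      "\<And>t z. \<i> * ut1 t z = bf_proj (\<lambda>w. of_real ((cmod (v1 t w))\<^sup>2) * u1 t w) z"
      "\<And>t z. \<i> * vt1 t z = - bf_proj (\<lambda>w. of_real ((cmod (u1 t w))\<^sup>2) * v1 t w) z"
    using f1 unfolding fock_flow_def Bex_def by metis
  obtain ut2 vt2 where d2: "\<And>t. ut2 t \<in> bargmann_fock" "\<And>t. vt2 t \<in> bargmann_fock"
      "\<And>t. has_L2_derivative u2 (ut2 t) t" "\<And>t. has_L2_derivative v2 (vt2 t) t"
      "\<And>t z. \<i> * ut2 t z = bf_proj (\<lambda>w. of_real ((cmod (v2 t w))\<^sup>2) * u2 t w) z"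
      "\<And>t z. \<i> * vt2 t z = - bf_proj (\<lambda>w. of_real ((cmod (u2 t w))\<^sup>2) * v2 t w) z"
    using f2 unfolding fock_flow_def Bex_def by metis
  let ?A = Abs_fock
  have der: "((\<lambda>s. ?A (u1 s)) has_vector_derivative ?A (ut1 t)) (at t)"
    "((\<lambda>s. ?A (v1 s)) has_vector_derivative ?A (vt1 t)) (at t)"
    "((\<lambda>s. ?A (u2 s)) has_vector_derivative ?A (ut2 t)) (at t)"
    "((\<lambda>s. ?A (v2 s)) has_vector_derivative ?A (vt2 t)) (at t)" for t
    by (intro has_vector_derivative_Abs_fock bf d1 d2)+
  have nrm: "norm (?A f - ?A g) = L2_norm (\<lambda>z. f z - g z)" "norm (?A f) = L2_norm f"
    if "f \<in> bargmann_fock" "g \<in> bargmann_fock" for f g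
    using that by (simp_all add: norm_fock.rep_eq minus_fock.rep_eq Abs_fock_inverse)
  have bounded: "\<exists>R. \<forall>s. \<bar>s\<bar> \<le> \<bar>T\<bar> \<longrightarrow> norm (x s) \<le> R" if "\<And>t. (x has_vector_derivative x' t) (at t)"
    for x :: "real \<Rightarrow> fock" and x'
  proof -
    have "continuous_on {-\<bar>T\<bar>..\<bar>T\<bar>} x"
      by (rule continuous_at_imp_continuous_on) (use that has_vector_derivative_continuous in blast)
    then have "bounded (x ` {-\<bar>T\<bar>..\<bar>T\<bar>})"
      by (intro compact_imp_bounded compact_continuous_image) auto
    then show ?thesis unfolding bounded_iff by (metis (no_types, lifting) abs_le_iff atLeastAtMost_iff image_eqI minus_le_iff)
  qed
  obtain R1 R2 R3 R4 where "\<And>s. \<bar>s\<bar> \<le> \<bar>T\<bar> \<Longrightarrow> norm (?A (u1 s)) \<le> R1" "\<And>s. \<bar>s\<bar> \<le> \<bar>T\<bar> \<Longrightarrow> norm (?A (v1 s)) \<le> R2"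
    "\<And>s. \<bar>s\<bar> \<le> \<bar>T\<bar> \<Longrightarrow> norm (?A (u2 s)) \<le> R3" "\<And>s. \<bar>s\<bar> \<le> \<bar>T\<bar> \<Longrightarrow> norm (?A (v2 s)) \<le> R4"
    using bounded[OF der(1)] bounded[OF der(2)] bounded[OF der(3)] bounded[OF der(4)] by metis
  moreover define R where "R = max (max R1 R2) (max R3 R4)"
  ultimately have R: "L2_norm (u1 s) \<le> R" "L2_norm (v1 s) \<le> R" "L2_norm (u2 s) \<le> R" "L2_norm (v2 s) \<le> R"
    if "\<bar>s\<bar> \<le> \<bar>T\<bar>" for s
    using that nrm(2)[OF bf(1) bf(1)] nrm(2)[OF bf(2) bf(2)] nrm(2)[OF bf(3) bf(3)] nrm(2)[OF bf(4) bf(4)]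
    by (metis max.coboundedI1 max.coboundedI2)+
  define B where "B = exp 1 / pi * R\<^sup>2"
  define X where "X s = (?A (u1 s) - ?A (u2 s), ?A (v1 s) - ?A (v2 s))" for s
  define X' where "X' s = (?A (ut1 s) - ?A (ut2 s), ?A (vt1 s) - ?A (vt2 s))" for s
  have normX: "(norm (X s))\<^sup>2 = (L2_norm (\<lambda>z. u1 s z - u2 s z))\<^sup>2 + (L2_norm (\<lambda>z. v1 s z - v2 s z))\<^sup>2" for s
    by (simp add: X_def norm_Pair nrm bf)
  have normX': "(norm (X' s))\<^sup>2 = (L2_norm (\<lambda>z. ut1 s z - ut2 s z))\<^sup>2 + (L2_norm (\<lambda>z. vt1 s z - vt2 s z))\<^sup>2" for s
    by (simp add: X'_def norm_Pair nrm d1 d2)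
  have "X T = 0"
  proof (rule gronwall_zero)
    show "(X has_vector_derivative X' s) (at s)" for s
      unfolding X_def X'_def by (intro has_vector_derivative_Pair has_vector_derivative_diff der)
    show "X 0 = 0" by (simp add: X_def init zero_prod_def)
    fix s assume s: "\<bar>s\<bar> \<le> \<bar>T\<bar>"
    have i_cancel: "L2_norm (\<lambda>z. f z - g z) = L2_norm (\<lambda>z. \<i> * f z - \<i> * g z)"
      "L2_norm (\<lambda>z. f z - g z) = L2_norm (\<lambda>z. - (\<i> * f z) - - (\<i> * g z))" for f g
      by (auto simp: L2_norm_def norm_mult norm_minus_commute simp flip: right_diff_distrib)
    have "(L2_norm (\<lambda>z. ut1 s z - ut2 s z))\<^sup>2 \<le> 32 * B\<^sup>2 * (norm (X s))\<^sup>2"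
      unfolding normX i_cancel(1)[of "ut1 s" "ut2 s"] d1(5) d2(5) B_def
      by (intro bf_proj_cubic_lipschitz bf R s)
    moreover have "(L2_norm (\<lambda>z. vt1 s z - vt2 s z))\<^sup>2 \<le> 32 * B\<^sup>2 * (norm (X s))\<^sup>2"
      unfolding normX i_cancel(2)[of "vt1 s" "vt2 s"] d1(6) d2(6) minus_minus B_def
      by (subst add.commute) (intro bf_proj_cubic_lipschitz bf R s)
    ultimately have "(norm (X' s))\<^sup>2 \<le> (8 * B * norm (X s))\<^sup>2"
      unfolding normX' by (simp add: power_mult_distrib)
    then show "norm (X' s) \<le> (8 * B) * norm (X s)"
      by (rule power2_le_imp_le) (auto simp: B_def)
  qed
  then have "?A (u1 T) = ?A (u2 T)" "?A (v1 T) = ?A (v2 T)"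
    by (simp_all add: X_def zero_prod_def)
  then show ?thesis using bf by (simp add: Abs_fock_inject)
qed

section \<open>The cubic term on Gaussian packets\<close>

text \<open>
  The Gaussian \<open>E\<^sub>\<gamma>\<close> centred at \<open>cnj \<gamma>\<close>, with an amplitude \<open>p\<close> that may depend on \<open>z\<close>. The
  functions \<^term>\<open>phi n \<gamma>\<close> are packets with amplitude proportional to \<open>(z - cnj \<gamma>)\<^sup>n\<close>.
\<close>

definition packet :: "complex \<Rightarrow> complex \<Rightarrow> complex \<Rightarrow> complex" where
  "packet \<gamma> p z = p * exp (- of_real ((cmod z)\<^sup>2 / 2) - of_real ((cmod \<gamma>)\<^sup>2 / 2) + \<gamma> * z)"

lemma packet_factor:
  "packet \<gamma> p z = exp (- of_real ((cmod z)\<^sup>2 / 2)) * (p * exp (\<gamma> * z - of_real ((cmod \<gamma>)\<^sup>2 / 2)))"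
proof -
  have "- of_real ((cmod z)\<^sup>2 / 2) - of_real ((cmod \<gamma>)\<^sup>2 / 2) + \<gamma> * z
      = - of_real ((cmod z)\<^sup>2 / 2) + (\<gamma> * z - of_real ((cmod \<gamma>)\<^sup>2 / 2) :: complex)" by simp
  then show ?thesis unfolding packet_def by (simp only: exp_add mult.left_commute)
qed

text \<open>
  Covariance of the cubic term under magnetic translation: in the coordinate \<open>\<omega>\<close> relative to the
  centre, the integrand of \<open>\<Pi>(|v|\<^sup>2 u)\<close> looks as it does for the centre 0.
\<close>

lemma packet_translated_exponent:
  "exp (cnj (cnj \<gamma> + \<omega>) * z - of_real ((cmod (cnj \<gamma> + \<omega>))\<^sup>2 / 2))
     * (of_real ((cmod (packet \<gamma> p (cnj \<gamma> + \<omega>)))\<^sup>2) * packet \<gamma> q (cnj \<gamma> + \<omega>))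
   = exp (\<gamma> * z - of_real ((cmod \<gamma>)\<^sup>2 / 2)) *
     (exp (cnj \<omega> * (z - cnj \<gamma>)) * (p * cnj p * q * of_real (exp (- 2 * (cmod \<omega>)\<^sup>2))))"
proof -
  have n1: "of_real ((cmod (cnj \<gamma> + \<omega>))\<^sup>2) = (cnj \<gamma> + \<omega>) * (\<gamma> + cnj \<omega>)"
    by (subst complex_norm_square) simp
  have n2: "of_real ((cmod \<gamma>)\<^sup>2) = \<gamma> * cnj \<gamma>" by (rule complex_norm_square)
  have n3: "of_real ((cmod \<omega>)\<^sup>2) = \<omega> * cnj \<omega>" by (rule complex_norm_square)
  have sq: "of_real ((cmod (packet \<gamma> p w))\<^sup>2) = p * cnj p * exp (- of_real ((cmod w)\<^sup>2) - of_real ((cmod \<gamma>)\<^sup>2) + \<gamma> * w + cnj (\<gamma> * w))" for w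
    by (subst complex_norm_square) (simp add: packet_def exp_cnj mult_exp_exp algebra_simps)
  show ?thesis
    unfolding sq unfolding packet_def
    by (simp add: mult_exp_exp n1 n2 n3 exp_of_real[symmetric] del: of_real_power)
       (intro disjI2 arg_cong[where f = exp], simp add: field_simps)
qed

text \<open>
  The product of the three linear amplitudes is a combination of the monomials \<open>\<omega>\<^sup>p cnj \<omega>\<^sup>q\<close> with
  \<open>p \<le> 2\<close> and \<open>q \<le> 1\<close>; each is integrated against the kernel separately.
\<close>

lemma bf_proj_packet:
  "bf_proj (\<lambda>w. of_real ((cmod (packet \<gamma> (c + d * (w - cnj \<gamma>)) w))\<^sup>2) * packet \<gamma> (a + b * (w - cnj \<gamma>)) w) z
   = packet \<gamma> ((a * c * cnj c / 2 + a * d * cnj d / 4 + b * c * cnj d / 4)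
       + (a * cnj c * d + b * c * cnj c + b * d * cnj d) / 4 * (z - cnj \<gamma>)
       + b * cnj c * d / 8 * (z - cnj \<gamma>)\<^sup>2) z"
proof -
  define \<zeta> where "\<zeta> = z - cnj \<gamma>"
  define m where "m p q \<omega> = exp (cnj \<omega> * \<zeta>) * (\<omega> ^ p * cnj \<omega> ^ q * of_real (exp (- 2 * (cmod \<omega>)\<^sup>2)))" for p q \<omega>
  have mi: "integrable lborel (m p q)" if "p \<le> 2" for p q
    unfolding m_def by (rule integral_fock_kernel_monomial(2)[OF that])
  have mv: "integral\<^sup>L lborel (m p q) = (if q \<le> p then \<zeta> ^ (p - q) / fact (p - q) * of_real (pi * fact p / 2 ^ Suc p) else 0)"
    if "p \<le> 2" for p q
    unfolding m_def by (rule integral_fock_kernel_monomial(1)[OF that])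
  let ?c = "exp (\<gamma> * z - of_real ((cmod \<gamma>)\<^sup>2 / 2))"
  let ?f = "\<lambda>w. exp (cnj w * z - of_real ((cmod w)\<^sup>2 / 2)) *
      (of_real ((cmod (packet \<gamma> (c + d * (w - cnj \<gamma>)) w))\<^sup>2) * packet \<gamma> (a + b * (w - cnj \<gamma>)) w)"
  have [measurable]: "?f \<in> borel_measurable borel"
    unfolding packet_def by measurable
  have "(\<integral>w. ?f w \<partial>lborel) = (\<integral>\<omega>. ?f (cnj \<gamma> + \<omega>) \<partial>lborel)"
    by (rule integral_translate[symmetric]) measurable
  also have "\<dots> = (\<integral>\<omega>. ?c * (a * c * cnj c * m 0 0 \<omega> + (b * c * cnj c + a * d * cnj c) * m 1 0 \<omega>
      + b * d * cnj c * m 2 0 \<omega> + a * c * cnj d * m 0 1 \<omega> + (b * c * cnj d + a * d * cnj d) * m 1 1 \<omega>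
      + b * d * cnj d * m 2 1 \<omega>) \<partial>lborel)"
    unfolding packet_translated_exponent m_def \<zeta>_def
    by (intro Bochner_Integration.integral_cong refl arg_cong[where f = "\<lambda>x. ?c * x"])
       (simp add: algebra_simps power2_eq_square)
  also have "\<dots> = ?c * (a * c * cnj c * integral\<^sup>L lborel (m 0 0) + (b * c * cnj c + a * d * cnj c) * integral\<^sup>L lborel (m 1 0)
      + b * d * cnj c * integral\<^sup>L lborel (m 2 0) + a * c * cnj d * integral\<^sup>L lborel (m 0 1)
      + (b * c * cnj d + a * d * cnj d) * integral\<^sup>L lborel (m 1 1)
      + b * d * cnj d * integral\<^sup>L lborel (m 2 1))"
    by (simp add: mi)
  also have "\<dots> = ?c * of_real pi * ((a * c * cnj c / 2 + a * d * cnj d / 4 + b * c * cnj d / 4)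
       + (a * cnj c * d + b * c * cnj c + b * d * cnj d) / 4 * \<zeta> + b * cnj c * d / 8 * \<zeta>\<^sup>2)"
    by (simp add: mv fact_numeral field_simps)
  finally have int: "(\<integral>w. ?f w \<partial>lborel) = ?c * of_real pi * ((a * c * cnj c / 2 + a * d * cnj d / 4 + b * c * cnj d / 4)
       + (a * cnj c * d + b * c * cnj c + b * d * cnj d) / 4 * \<zeta> + b * cnj c * d / 8 * \<zeta>\<^sup>2)" .
  show ?thesis
    unfolding bf_proj_def int unfolding packet_factor \<zeta>_def[symmetric] by (simp add: mult.assoc mult.left_commute)
qed

section \<open>Differentiability in time\<close>

lemma exp_type_in_bargmann_fock:
  assumes f: "f holomorphic_on UNIV" and b: "\<And>z. cmod (f z) \<le> C * exp (k * cmod z)"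
  shows "(\<lambda>z. exp (- of_real ((cmod z)\<^sup>2 / 2)) * f z) \<in> bargmann_fock"
proof (rule bargmann_fockI[OF f refl])
  have [measurable]: "f \<in> borel_measurable borel"
    using f by (intro borel_measurable_continuous_onI holomorphic_on_imp_continuous_on)
  have "integrable lborel (\<lambda>z. (cmod (exp (- of_real ((cmod z)\<^sup>2 / 2)) * f z))\<^sup>2)"
  proof (rule integrable_gaussian_bound[of 1 _ "C\<^sup>2" "2 * k"])
    fix z
    have "(cmod (f z))\<^sup>2 \<le> (C * exp (k * cmod z))\<^sup>2"
      by (intro power_mono b) auto
    then have "exp (- (cmod z)\<^sup>2) * (cmod (f z))\<^sup>2 \<le> exp (- (cmod z)\<^sup>2) * (C * exp (k * cmod z))\<^sup>2"
      by (intro mult_left_mono) auto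
    also have "\<dots> = C\<^sup>2 * exp (2 * k * cmod z - 1 * (cmod z)\<^sup>2)"
      by (simp add: power_mult_distrib exp_diff exp_minus field_simps flip: exp_double)
    also have "exp (- (cmod z)\<^sup>2) * (cmod (f z))\<^sup>2 = (cmod (exp (- of_real ((cmod z)\<^sup>2 / 2)) * f z))\<^sup>2"
      by (simp add: norm_mult norm_exp power_mult_distrib flip: exp_double)
    finally show "norm ((cmod (exp (- of_real ((cmod z)\<^sup>2 / 2)) * f z))\<^sup>2) \<le> C\<^sup>2 * exp (2 * k * cmod z - 1 * (cmod z)\<^sup>2)"
      by simp
  qed auto
  then show "square_integrable (\<lambda>z. exp (- of_real ((cmod z)\<^sup>2 / 2)) * f z)"
    by (simp add: square_integrable_def)
qed

lemma quadratic_le_exp: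
  fixes p0 p1 p2 \<zeta> :: complex
  shows "cmod (p0 + p1 * \<zeta> + p2 * \<zeta>\<^sup>2) \<le> (cmod p0 + cmod p1 + 2 * cmod p2) * exp (cmod \<zeta>)"
proof -
  have "cmod (p0 + p1 * \<zeta> + p2 * \<zeta>\<^sup>2) \<le> cmod p0 + cmod p1 * cmod \<zeta> + cmod p2 * (cmod \<zeta>)\<^sup>2"
    by (intro order_trans[OF norm_triangle_ineq] add_mono) (auto simp: norm_mult norm_power)
  also have "\<dots> \<le> cmod p0 * exp (cmod \<zeta>) + cmod p1 * exp (cmod \<zeta>) + cmod p2 * (2 * exp (cmod \<zeta>))"
    using power_le_fact_exp[of "cmod \<zeta>" 1] power_le_fact_exp[of "cmod \<zeta>" 2]
    by (intro add_mono mult_left_mono) (auto simp: mult_le_cancel_left1)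
  finally show ?thesis by (simp add: algebra_simps)
qed

lemma packet_in_bargmann_fock:
  "(\<lambda>z. packet \<gamma> (p0 + p1 * (z - cnj \<gamma>) + p2 * (z - cnj \<gamma>)\<^sup>2) z) \<in> bargmann_fock"
proof -
  let ?f = "\<lambda>z. (p0 + p1 * (z - cnj \<gamma>) + p2 * (z - cnj \<gamma>)\<^sup>2) * exp (\<gamma> * z - of_real ((cmod \<gamma>)\<^sup>2 / 2))"
  let ?P = "cmod p0 + cmod p1 + 2 * cmod p2"
  have "(\<lambda>z. exp (- of_real ((cmod z)\<^sup>2 / 2)) * ?f z) \<in> bargmann_fock"
  proof (rule exp_type_in_bargmann_fock[where C = "?P * exp (cmod \<gamma>)" and k = "1 + cmod \<gamma>"])
    show "?f holomorphic_on UNIV" by (intro holomorphic_intros)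
    fix z
    have "cmod (p0 + p1 * (z - cnj \<gamma>) + p2 * (z - cnj \<gamma>)\<^sup>2) \<le> ?P * exp (cmod (z - cnj \<gamma>))"
      by (rule quadratic_le_exp)
    also have "\<dots> \<le> ?P * exp (cmod z + cmod \<gamma>)"
      using norm_triangle_ineq4[of z "cnj \<gamma>"] by (intro mult_left_mono) auto
    finally have 1: "cmod (p0 + p1 * (z - cnj \<gamma>) + p2 * (z - cnj \<gamma>)\<^sup>2) \<le> ?P * exp (cmod z + cmod \<gamma>)" .
    have "Re (\<gamma> * z - of_real ((cmod \<gamma>)\<^sup>2 / 2)) \<le> cmod \<gamma> * cmod z"
      using complex_Re_le_cmod[of "\<gamma> * z"] zero_le_power2[of "cmod \<gamma>"]
      unfolding minus_complex.sel Re_complex_of_real norm_mult by linarith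
    then have 2: "cmod (exp (\<gamma> * z - of_real ((cmod \<gamma>)\<^sup>2 / 2))) \<le> exp (cmod \<gamma> * cmod z)"
      by (simp only: norm_exp_eq_Re exp_le_cancel_iff)
    have "cmod (?f z) \<le> (?P * exp (cmod z + cmod \<gamma>)) * exp (cmod \<gamma> * cmod z)"
      unfolding norm_mult by (intro mult_mono 1 2) auto
    then show "cmod (?f z) \<le> ?P * exp (cmod \<gamma>) * exp ((1 + cmod \<gamma>) * cmod z)"
      by (simp add: exp_add algebra_simps)
  qed
  then show ?thesis unfolding packet_factor .
qed

lemma L2_norm_mono:
  assumes le: "\<And>z. cmod (f z) \<le> c * M z" and M: "integrable lborel (\<lambda>z. (M z)\<^sup>2)"
  shows "L2_norm f \<le> \<bar>c\<bar> * sqrt (\<integral>z. (M z)\<^sup>2 \<partial>lborel)"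
proof -
  have "(\<integral>z. (cmod (f z))\<^sup>2 \<partial>lborel) \<le> (\<integral>z. c\<^sup>2 * (M z)\<^sup>2 \<partial>lborel)"
  proof (rule integral_mono')
    show "integrable lborel (\<lambda>z. c\<^sup>2 * (M z)\<^sup>2)" by (intro integrable_mult_right M)
    show "(cmod (f z))\<^sup>2 \<le> c\<^sup>2 * (M z)\<^sup>2" for z
      unfolding power_mult_distrib[symmetric] by (intro power_mono le) auto
  qed auto
  then have "L2_norm f \<le> sqrt (c\<^sup>2 * (\<integral>z. (M z)\<^sup>2 \<partial>lborel))"
    unfolding L2_norm_def by (intro real_sqrt_le_mono) simp
  then show ?thesis by (simp add: real_sqrt_mult)
qed

lemma cauchy_quadratic_remainder:
  assumes f: "f holomorphic_on UNIV" and M: "\<And>\<tau>. cmod (\<tau> - t) \<le> 2 \<Longrightarrow> cmod (f \<tau>) \<le> M"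
    and h: "cmod h \<le> 1"
  shows "cmod (f (t + h) - f t - deriv f t * h) \<le> 2 * M * (cmod h)\<^sup>2"
proof -
  have hol: "(deriv ^^ i) f holomorphic_on UNIV" for i
    using f by (intro holomorphic_higher_deriv) auto
  have "cmod ((deriv ^^ 0) f (t + h) - (\<Sum>i\<le>1. (deriv ^^ i) f t * ((t + h) - t) ^ i / fact i))
      \<le> 2 * M * cmod ((t + h) - t) ^ Suc 1 / fact 1"
  proof (rule complex_Taylor[where S = "cball t 1"])
    fix i x
    show "((deriv ^^ i) f has_field_derivative (deriv ^^ Suc i) f x) (at x within cball t 1)"
      using holomorphic_derivI[OF hol[of i], of x] by (auto intro: has_field_derivative_at_within)
  next
    fix x assume x: "x \<in> cball t 1"
    have "cmod ((deriv ^^ Suc 1) f x) \<le> fact (Suc 1) * M / 1 ^ Suc 1"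
    proof (rule Cauchy_inequality)
      show "f holomorphic_on ball x 1" using f by (rule holomorphic_on_subset) auto
      show "continuous_on (cball x 1) f"
        using holomorphic_on_imp_continuous_on[OF f] by (rule continuous_on_subset) auto
      fix y assume "cmod (x - y) = 1"
      then have "cmod (y - t) \<le> 2"
        using x norm_triangle_ineq[of "y - x" "x - t"] by (simp add: dist_norm norm_minus_commute)
      then show "cmod (f y) \<le> M" by (rule M)
    qed simp
    then show "cmod ((deriv ^^ Suc 1) f x) \<le> 2 * M" by (simp add: fact_numeral)
  qed (use h in \<open>auto simp: dist_norm\<close>)
  then show ?thesis by (simp add: power2_eq_square algebra_simps)
qed

text \<open>
  A curve that extends holomorphically to complex times is differentiable in \<open>L\<^sup>2\<close> as soon as it has a
  square integrable bound on a complex disc around the given time: Cauchy's inequality then controls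
  the quadratic Taylor remainder pointwise in \<open>z\<close>, so that no second derivative has to be computed.
\<close>

lemma has_L2_derivative_holomorphic:
  assumes hol: "\<And>z. (\<lambda>\<tau>. W \<tau> z) holomorphic_on UNIV"
    and M: "\<And>\<tau> z. cmod (\<tau> - of_real t) \<le> 2 \<Longrightarrow> cmod (W \<tau> z) \<le> M z"
    and int: "integrable lborel (\<lambda>z. (M z)\<^sup>2)"
  shows "has_L2_derivative (\<lambda>s. W (of_real s)) (\<lambda>z. deriv (\<lambda>\<tau>. W \<tau> z) (of_real t)) t"
proof -
  define N where "N = sqrt (\<integral>z. (M z)\<^sup>2 \<partial>lborel)"
  let ?q = "\<lambda>h z. (W (of_real (t + h)) z - W (of_real t) z) / of_real h - deriv (\<lambda>\<tau>. W \<tau> z) (of_real t)"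
  have "L2_norm (?q h) \<le> \<bar>2 * \<bar>h\<bar>\<bar> * N" if h: "h \<noteq> 0" "\<bar>h\<bar> < 1" for h
    unfolding N_def
  proof (rule L2_norm_mono[OF _ int])
    fix z
    have "cmod (W (of_real t + of_real h) z - W (of_real t) z - deriv (\<lambda>\<tau>. W \<tau> z) (of_real t) * of_real h)
        \<le> 2 * M z * (cmod (of_real h))\<^sup>2"
      by (rule cauchy_quadratic_remainder[OF hol M]) (use h in auto)
    moreover have "?q h z = (W (of_real t + of_real h) z - W (of_real t) z - deriv (\<lambda>\<tau>. W \<tau> z) (of_real t) * of_real h) / of_real h"
      using h by (simp add: field_simps)
    ultimately show "cmod (?q h z) \<le> 2 * \<bar>h\<bar> * M z"
      using h by (simp add: norm_divide divide_le_eq power2_eq_square mult_ac)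
  qed
  then have "\<forall>\<^sub>F h in at 0. norm (L2_norm (?q h)) \<le> \<bar>2 * \<bar>h\<bar>\<bar> * N"
    unfolding eventually_at by (intro exI[of _ 1]) (auto simp: dist_norm L2_norm_nonneg)
  moreover have "((\<lambda>h. \<bar>2 * \<bar>h\<bar>\<bar> * N) \<longlongrightarrow> 0) (at (0::real))"
    by (auto intro!: tendsto_eq_intros)
  ultimately show ?thesis
    unfolding has_L2_derivative_def by (rule Lim_null_comparison)
qed

section \<open>The travelling wave\<close>

text \<open>
  A packet with linear amplitude relative to its centre, which moves with constant velocity, and
  with a phase of constant frequency \<open>l\<close>.
\<close>

definition wave :: "real \<Rightarrow> complex \<Rightarrow> complex \<Rightarrow> complex \<Rightarrow> complex \<Rightarrow> real \<Rightarrow> complex \<Rightarrow> complex" where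
  "wave l a b \<gamma>0 \<delta> t z =
     exp (- \<i> * of_real l * of_real t) *
     packet (\<gamma>0 + of_real t * \<delta>) (a + b * (z - cnj (\<gamma>0 + of_real t * \<delta>))) z"

text \<open>
  The extension to complex times replaces \<open>cnj \<gamma>\<close> by \<open>cnj \<gamma>0 + \<tau> cnj \<delta>\<close>. The constant \<open>\<mu>\<close> is the
  phase velocity caused by the motion of the centre; it does not depend on \<open>t\<close> because
  \<open>cnj \<delta> \<delta>\<close> is real.
\<close>

lemma wave_has_L2_derivative:
  fixes l :: real and a b \<gamma>0 \<delta> :: complex and t :: real
  defines "\<gamma> \<equiv> \<gamma>0 + of_real t * \<delta>" and "\<mu> \<equiv> Im (cnj \<gamma>0 * \<delta>)"
  shows "has_L2_derivative (wave l a b \<gamma>0 \<delta>)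
    (\<lambda>z. exp (- \<i> * of_real l * of_real t) * packet \<gamma>
       ((\<i> * of_real (\<mu> - l) * a - b * cnj \<delta>) + (\<i> * of_real (\<mu> - l) * b + a * \<delta>) * (z - cnj \<gamma>)
         + b * \<delta> * (z - cnj \<gamma>)\<^sup>2) z) t"
proof -
  define W where "W \<tau> z = exp (- \<i> * of_real l * \<tau>) * ((a + b * (z - (cnj \<gamma>0 + \<tau> * cnj \<delta>))) *
     exp (- of_real ((cmod z)\<^sup>2 / 2) - (\<gamma>0 + \<tau> * \<delta>) * (cnj \<gamma>0 + \<tau> * cnj \<delta>) / 2 + (\<gamma>0 + \<tau> * \<delta>) * z))" for \<tau> z
  have n: "of_real ((cmod x)\<^sup>2 / 2) = x * cnj x / 2" for x
    by (simp only: of_real_divide complex_norm_square) simp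
  have waveW: "wave l a b \<gamma>0 \<delta> = (\<lambda>s. W (of_real s))"
    unfolding wave_def W_def packet_def n[of "\<gamma>0 + _"] by (simp add: fun_eq_iff)
  have mu: "2 * \<i> * of_real \<mu> = \<delta> * cnj \<gamma>0 - cnj \<delta> * \<gamma>0"
    by (simp add: \<mu>_def complex_eq_iff)
  have derivW: "deriv (\<lambda>\<tau>. W \<tau> z) (of_real t) = exp (- \<i> * of_real l * of_real t) * packet \<gamma>
       ((\<i> * of_real (\<mu> - l) * a - b * cnj \<delta>) + (\<i> * of_real (\<mu> - l) * b + a * \<delta>) * (z - cnj \<gamma>)
         + b * \<delta> * (z - cnj \<gamma>)\<^sup>2) z" for z
  proof (rule DERIV_imp_deriv)
    let ?e1 = "exp (- \<i> * of_real l * of_real t)"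
    let ?P = "a + b * (z - (cnj \<gamma>0 + of_real t * cnj \<delta>))"
    let ?E = "exp (- of_real ((cmod z)\<^sup>2 / 2) - (\<gamma>0 + of_real t * \<delta>) * (cnj \<gamma>0 + of_real t * cnj \<delta>) / 2 + (\<gamma>0 + of_real t * \<delta>) * z)"
    let ?q = "\<delta> * z - (\<delta> * (cnj \<gamma>0 + of_real t * cnj \<delta>) + (\<gamma>0 + of_real t * \<delta>) * cnj \<delta>) / 2"
    have D: "((\<lambda>\<tau>. W \<tau> z) has_field_derivative
        (?e1 * (- \<i> * of_real l) * (?P * ?E) + ?e1 * ((- b * cnj \<delta>) * ?E + ?P * (?E * ?q)))) (at (of_real t))"
      unfolding W_def by (auto intro!: derivative_eq_intros)
    have q: "?q = \<delta> * (z - cnj \<gamma>) + \<i> * of_real \<mu>"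
    proof -
      have "?q = \<delta> * (z - cnj \<gamma>) + (\<delta> * cnj \<gamma>0 - cnj \<delta> * \<gamma>0) / 2"
        by (simp add: \<gamma>_def field_simps)
      then show ?thesis unfolding mu[symmetric] by simp
    qed
    have E: "?E = exp (- of_real ((cmod z)\<^sup>2 / 2) - of_real ((cmod \<gamma>)\<^sup>2 / 2) + \<gamma> * z)"
      unfolding n[of \<gamma>] by (simp add: \<gamma>_def)
    have P: "?P = a + b * (z - cnj \<gamma>)" by (simp add: \<gamma>_def)
    have "?e1 * (- \<i> * of_real l) * (p * E') + ?e1 * ((- b * cnj \<delta>) * E' + p * (E' * (\<delta> * \<zeta> + \<i> * of_real \<mu>)))
        = ?e1 * (((\<i> * of_real (\<mu> - l) * a - b * cnj \<delta>) + (\<i> * of_real (\<mu> - l) * b + a * \<delta>) * \<zeta> + b * \<delta> * \<zeta>\<^sup>2) * E')"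
      if "p = a + b * \<zeta>" for p E' \<zeta>
      unfolding that by (simp add: algebra_simps power2_eq_square)
    from D[unfolded q, unfolded this[OF P]] show "((\<lambda>\<tau>. W \<tau> z) has_field_derivative ?e1 * packet \<gamma>
       ((\<i> * of_real (\<mu> - l) * a - b * cnj \<delta>) + (\<i> * of_real (\<mu> - l) * b + a * \<delta>) * (z - cnj \<gamma>)
         + b * \<delta> * (z - cnj \<gamma>)\<^sup>2) z) (at (of_real t))"
      unfolding packet_def E[symmetric] .
  qed
  \<comment> \<open>on the disc of radius 2 around \<open>t\<close>, \<open>r\<close> bounds the modulus of the complex time and \<open>G\<close> that of \<open>\<gamma>\<close>\<close>
  define r where "r = \<bar>t\<bar> + 2"
  define G where "G = cmod \<gamma>0 + r * cmod \<delta>"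
  define C where "C = exp (\<bar>l\<bar> * r) * ((cmod a + cmod b * (1 + G)) * exp (G\<^sup>2 / 2))"
  have "has_L2_derivative (\<lambda>s. W (of_real s)) (\<lambda>z. deriv (\<lambda>\<tau>. W \<tau> z) (of_real t)) t"
  proof (rule has_L2_derivative_holomorphic[where M = "\<lambda>z. C * exp ((1 + G) * cmod z - (cmod z)\<^sup>2 / 2)"])
    show "(\<lambda>\<tau>. W \<tau> z) holomorphic_on UNIV" for z
      unfolding W_def by (intro holomorphic_intros) auto
    show "integrable lborel (\<lambda>z. (C * exp ((1 + G) * cmod z - (cmod z)\<^sup>2 / 2))\<^sup>2)"
    proof (rule integrable_gaussian_bound[of 1 _ "C\<^sup>2" "2 * (1 + G)"])
      show "norm ((C * exp ((1 + G) * cmod z - (cmod z)\<^sup>2 / 2))\<^sup>2) \<le> C\<^sup>2 * exp (2 * (1 + G) * cmod z - 1 * (cmod z)\<^sup>2)" for z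
        by (simp add: power_mult_distrib algebra_simps flip: exp_double)
    qed auto
    fix \<tau> z :: complex assume "cmod (\<tau> - of_real t) \<le> 2"
    then have \<tau>: "cmod \<tau> \<le> r"
      using norm_triangle_ineq[of "\<tau> - of_real t" "of_real t"] by (simp add: r_def)
    have g: "cmod (\<gamma>0 + \<tau> * \<delta>) \<le> G" "cmod (cnj \<gamma>0 + \<tau> * cnj \<delta>) \<le> G"
      unfolding G_def using \<tau>
      by (auto intro!: norm_triangle_le add_mono mult_right_mono simp: norm_mult)
    have G0: "0 \<le> G" using g(1) norm_ge_zero order_trans by blast
    have e1: "cmod (exp (- \<i> * of_real l * \<tau>)) \<le> exp (\<bar>l\<bar> * r)"
    proof -
      have "cmod (- \<i> * of_real l * \<tau>) \<le> \<bar>l\<bar> * r"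
        using \<tau> by (simp add: norm_mult mult_left_mono)
      then show ?thesis
        using norm_exp[of "- \<i> * of_real l * \<tau>"] by (meson exp_le_cancel_iff order_trans)
    qed
    have "cmod (a + b * (z - (cnj \<gamma>0 + \<tau> * cnj \<delta>))) \<le> cmod a + cmod b * (cmod z + G)"
      using g(2) by (intro norm_triangle_le add_mono) (auto simp: norm_mult intro!: mult_left_mono norm_triangle_le_diff)
    also have "\<dots> \<le> cmod a * exp (cmod z) + cmod b * ((1 + G) * exp (cmod z))"
    proof (intro add_mono mult_left_mono)
      have "G * 1 \<le> G * exp (cmod z)" using G0 by (intro mult_left_mono) auto
      moreover have "cmod z \<le> exp (cmod z)" using exp_ge_add_one_self[of "cmod z"] by linarith
      ultimately show "cmod z + G \<le> (1 + G) * exp (cmod z)" by (simp add: algebra_simps)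
      show "cmod a \<le> cmod a * exp (cmod z)" by (simp add: mult_le_cancel_left1)
    qed auto
    finally have P: "cmod (a + b * (z - (cnj \<gamma>0 + \<tau> * cnj \<delta>))) \<le> (cmod a + cmod b * (1 + G)) * exp (cmod z)"
      by (simp add: algebra_simps)
    have "Re (- of_real ((cmod z)\<^sup>2 / 2) - (\<gamma>0 + \<tau> * \<delta>) * (cnj \<gamma>0 + \<tau> * cnj \<delta>) / 2 + (\<gamma>0 + \<tau> * \<delta>) * z)
       \<le> - ((cmod z)\<^sup>2 / 2) + G\<^sup>2 / 2 + G * cmod z"
    proof -
      have "cmod ((\<gamma>0 + \<tau> * \<delta>) * (cnj \<gamma>0 + \<tau> * cnj \<delta>)) \<le> G * G"
        unfolding norm_mult using g G0 by (intro mult_mono) auto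
      then have 1: "- Re ((\<gamma>0 + \<tau> * \<delta>) * (cnj \<gamma>0 + \<tau> * cnj \<delta>)) \<le> G\<^sup>2"
        using abs_Re_le_cmod[of "(\<gamma>0 + \<tau> * \<delta>) * (cnj \<gamma>0 + \<tau> * cnj \<delta>)"] unfolding power2_eq_square by linarith
      have "cmod ((\<gamma>0 + \<tau> * \<delta>) * z) \<le> G * cmod z"
        unfolding norm_mult using g G0 by (intro mult_mono) auto
      then have 2: "Re ((\<gamma>0 + \<tau> * \<delta>) * z) \<le> G * cmod z"
        using complex_Re_le_cmod order_trans by blast
      show ?thesis using 1 2 unfolding plus_complex.sel minus_complex.sel uminus_complex.sel Re_complex_of_real Re_divide_numeral
        by linarith
    qed
    then have E: "cmod (exp (- of_real ((cmod z)\<^sup>2 / 2) - (\<gamma>0 + \<tau> * \<delta>) * (cnj \<gamma>0 + \<tau> * cnj \<delta>) / 2 + (\<gamma>0 + \<tau> * \<delta>) * z))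
       \<le> exp (- ((cmod z)\<^sup>2 / 2) + G\<^sup>2 / 2 + G * cmod z)"
      by (simp only: norm_exp_eq_Re exp_le_cancel_iff)
    have "cmod (W \<tau> z) \<le> exp (\<bar>l\<bar> * r) * (((cmod a + cmod b * (1 + G)) * exp (cmod z)) * exp (- ((cmod z)\<^sup>2 / 2) + G\<^sup>2 / 2 + G * cmod z))"
      unfolding W_def norm_mult using G0 by (intro mult_mono e1 P E) auto
    also have "\<dots> = C * exp (cmod z + (- ((cmod z)\<^sup>2 / 2) + G * cmod z))"
      unfolding C_def exp_add by simp
    also have "cmod z + (- ((cmod z)\<^sup>2 / 2) + G * cmod z) = (1 + G) * cmod z - (cmod z)\<^sup>2 / 2"
      by (simp add: algebra_simps)
    finally show "cmod (W \<tau> z) \<le> C * exp ((1 + G) * cmod z - (cmod z)\<^sup>2 / 2)" .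
  qed
  then show ?thesis unfolding waveW derivW .
qed

lemma wave_in_bargmann_fock: "wave l a b \<gamma>0 \<delta> t \<in> bargmann_fock"
  using bargmann_fock_mult[OF packet_in_bargmann_fock[of "\<gamma>0 + of_real t * \<delta>" a b 0],
      of "exp (- \<i> * of_real l * of_real t)"]
  by (simp add: wave_def[abs_def])

text \<open>
  The sign \<open>\<sigma>\<close> treats both equations of the system at once. The hypotheses on \<open>cnj a * b\<close> and
  \<open>cnj c * d\<close> match the terms of degree 2 and fix the velocity. Beyond the common
  summand \<open>\<mu>\<close>, comparing the terms of degree 0 gives the frequency
  \<open>(|a|\<^sup>2/2 + |b|\<^sup>2/8) \<sigma>\<close>, and those of degree 1 give \<open>(|a|\<^sup>2/8 + |b|\<^sup>2/4) \<sigma>\<close>; they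
  coincide for \<open>|b|\<^sup>2 = 3 |a|\<^sup>2\<close>, with the common value \<open>7/8 |a|\<^sup>2 \<sigma>\<close>.
\<close>

lemma wave_equation:
  fixes a b c d \<gamma>0 \<delta> :: complex and A \<sigma> l l' t :: real
  defines "\<gamma> \<equiv> \<gamma>0 + of_real t * \<delta>" and "\<mu> \<equiv> Im (cnj \<gamma>0 * \<delta>)"
  assumes \<sigma>: "\<sigma> * \<sigma> = 1" and l: "l = \<mu> + \<sigma> * (7 / 8 * A)"
    and ab: "cnj a * b = - 8 * of_real \<sigma> * \<i> * \<delta>" and cd: "cnj c * d = 8 * of_real \<sigma> * \<i> * \<delta>"
    and A: "a * cnj a = of_real A" "b * cnj b = 3 * of_real A" "c * cnj c = of_real A" "d * cnj d = 3 * of_real A"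
  obtains wt where "wt \<in> bargmann_fock" "has_L2_derivative (wave l a b \<gamma>0 \<delta>) wt t"
    "\<And>z. \<i> * wt z = of_real \<sigma> * bf_proj (\<lambda>w. of_real ((cmod (wave l' c d \<gamma>0 \<delta> t w))\<^sup>2) * wave l a b \<gamma>0 \<delta> t w) z"
proof
  let ?e = "exp (- \<i> * of_real l * of_real t)"
  let ?wt = "\<lambda>z. ?e * packet \<gamma>
       ((\<i> * of_real (\<mu> - l) * a - b * cnj \<delta>) + (\<i> * of_real (\<mu> - l) * b + a * \<delta>) * (z - cnj \<gamma>)
         + b * \<delta> * (z - cnj \<gamma>)\<^sup>2) z"
  show "?wt \<in> bargmann_fock" by (intro bargmann_fock_mult packet_in_bargmann_fock)
  show "has_L2_derivative (wave l a b \<gamma>0 \<delta>) ?wt t"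
    unfolding \<gamma>_def \<mu>_def by (rule wave_has_L2_derivative)
  have \<sigma>c: "of_real \<sigma> * of_real \<sigma> = (1::complex)"
    by (simp only: \<sigma> of_real_1 flip: of_real_mult)
  have ab': "a * cnj b = 8 * of_real \<sigma> * \<i> * cnj \<delta>" using arg_cong[OF ab, of cnj] by simp
  have cd': "c * cnj d = - 8 * of_real \<sigma> * \<i> * cnj \<delta>" using arg_cong[OF cd, of cnj] by simp
  have ib: "\<i> * (b * cnj \<delta>) = of_real \<sigma> * (3 / 8 * of_real A * a)"
  proof -
    have "3 * of_real A * a = b * (a * cnj b)" by (simp flip: A(2))
    also have "\<dots> = 8 * of_real \<sigma> * (\<i> * (b * cnj \<delta>))" unfolding ab' by simp
    finally have "of_real \<sigma> * (3 * of_real A * a) = 8 * (of_real \<sigma> * of_real \<sigma>) * (\<i> * (b * cnj \<delta>))" by simp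
    then show ?thesis unfolding \<sigma>c by simp
  qed
  have ia: "\<i> * (a * \<delta>) = - of_real \<sigma> * (of_real A * b / 8)"
  proof -
    have "of_real A * b = a * (cnj a * b)" by (simp flip: A(1))
    also have "\<dots> = - 8 * of_real \<sigma> * (\<i> * (a * \<delta>))" unfolding ab by simp
    finally have "of_real \<sigma> * (of_real A * b) = - 8 * (of_real \<sigma> * of_real \<sigma>) * (\<i> * (a * \<delta>))" by simp
    then show ?thesis unfolding \<sigma>c by simp
  qed
  have il: "\<i> * (\<i> * of_real (\<mu> - l) * x) = of_real \<sigma> * (7 / 8 * of_real A * x)" for x
    by (simp add: l flip: mult.assoc)
  have k0: "\<i> * (\<i> * of_real (\<mu> - l) * a - b * cnj \<delta>)
     = of_real \<sigma> * (a * c * cnj c / 2 + a * d * cnj d / 4 + b * c * cnj d / 4)"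
  proof -
    have "of_real \<sigma> * (a * c * cnj c / 2 + a * d * cnj d / 4 + b * c * cnj d / 4)
      = of_real \<sigma> * (a * (c * cnj c) / 2 + a * (d * cnj d) / 4 + b * (c * cnj d) / 4)" by (simp add: mult.assoc)
    also have "\<dots> = of_real \<sigma> * (5 / 4 * of_real A * a) - 2 * (of_real \<sigma> * of_real \<sigma>) * (\<i> * (b * cnj \<delta>))"
      unfolding A cd' by (simp add: algebra_simps)
    also have "\<dots> = of_real \<sigma> * (1 / 2 * of_real A * a)"
      unfolding \<sigma>c ib by (simp add: algebra_simps)
    also have "\<dots> = \<i> * (\<i> * of_real (\<mu> - l) * a) - \<i> * (b * cnj \<delta>)"
      unfolding il ib by (simp add: algebra_simps)
    finally show ?thesis by (simp add: right_diff_distrib)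
  qed
  have k1: "\<i> * (\<i> * of_real (\<mu> - l) * b + a * \<delta>)
     = of_real \<sigma> * ((a * cnj c * d + b * c * cnj c + b * d * cnj d) / 4)"
  proof -
    have "of_real \<sigma> * ((a * cnj c * d + b * c * cnj c + b * d * cnj d) / 4)
      = of_real \<sigma> * ((a * (cnj c * d) + b * (c * cnj c) + b * (d * cnj d)) / 4)" by (simp add: mult.assoc)
    also have "\<dots> = of_real \<sigma> * (of_real A * b) + 2 * (of_real \<sigma> * of_real \<sigma>) * (\<i> * (a * \<delta>))"
      unfolding A cd by (simp add: algebra_simps)
    also have "\<dots> = of_real \<sigma> * (3 / 4 * of_real A * b)"
      unfolding \<sigma>c ia by (simp add: algebra_simps)
    also have "\<dots> = \<i> * (\<i> * of_real (\<mu> - l) * b) + \<i> * (a * \<delta>)"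
      unfolding il ia by (simp add: algebra_simps)
    finally show ?thesis by (simp add: distrib_left)
  qed
  have k2: "\<i> * (b * \<delta>) = of_real \<sigma> * (b * cnj c * d / 8)"
  proof -
    have "of_real \<sigma> * (b * cnj c * d / 8) = of_real \<sigma> * (b * (cnj c * d) / 8)" by (simp add: mult.assoc)
    also have "\<dots> = (of_real \<sigma> * of_real \<sigma>) * (\<i> * (b * \<delta>))" unfolding cd by simp
    finally have "of_real \<sigma> * (b * cnj c * d / 8) = \<i> * (b * \<delta>)" unfolding \<sigma>c mult_1_left .
    then show ?thesis by (rule sym)
  qed
  fix z
  define \<zeta> where "\<zeta> = z - cnj \<gamma>"
  have scale: "bf_proj (\<lambda>w. k * F w) z = k * bf_proj F z" for k F
    unfolding bf_proj_def by (simp add: mult.left_commute[of _ k])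
  have packet_mult: "k * packet \<gamma> p z = packet \<gamma> (k * p) z" for k p
    by (simp add: packet_def)
  have "bf_proj (\<lambda>w. of_real ((cmod (wave l' c d \<gamma>0 \<delta> t w))\<^sup>2) * wave l a b \<gamma>0 \<delta> t w) z
      = bf_proj (\<lambda>w. ?e * (of_real ((cmod (packet \<gamma> (c + d * (w - cnj \<gamma>)) w))\<^sup>2) * packet \<gamma> (a + b * (w - cnj \<gamma>)) w)) z"
    unfolding wave_def \<gamma>_def[symmetric] by (simp add: norm_mult ac_simps)
  also have "\<dots> = ?e * packet \<gamma> ((a * c * cnj c / 2 + a * d * cnj d / 4 + b * c * cnj d / 4)
       + (a * cnj c * d + b * c * cnj c + b * d * cnj d) / 4 * \<zeta>
       + b * cnj c * d / 8 * \<zeta>\<^sup>2) z" (is "_ = ?e * packet \<gamma> ?q z")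
    unfolding scale bf_proj_packet \<zeta>_def ..
  finally have R: "bf_proj (\<lambda>w. of_real ((cmod (wave l' c d \<gamma>0 \<delta> t w))\<^sup>2) * wave l a b \<gamma>0 \<delta> t w) z
      = ?e * packet \<gamma> ?q z" .
  let ?p = "(\<i> * of_real (\<mu> - l) * a - b * cnj \<delta>) + (\<i> * of_real (\<mu> - l) * b + a * \<delta>) * \<zeta> + b * \<delta> * \<zeta>\<^sup>2"
  have "\<i> * (p0 + p1 * \<zeta> + p2 * \<zeta>\<^sup>2) = \<i> * p0 + \<i> * p1 * \<zeta> + \<i> * p2 * \<zeta>\<^sup>2" for p0 p1 p2
    by (simp add: distrib_left)
  then have "\<i> * ?p = \<i> * (\<i> * of_real (\<mu> - l) * a - b * cnj \<delta>) + \<i> * (\<i> * of_real (\<mu> - l) * b + a * \<delta>) * \<zeta> + \<i> * (b * \<delta>) * \<zeta>\<^sup>2" .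
  also have "\<dots> = of_real \<sigma> * ?q"
    unfolding k0 k1 k2 by (simp only: distrib_left mult.assoc)
  finally have "\<i> * ?p = of_real \<sigma> * ?q" .
  then have "?e * packet \<gamma> (\<i> * ?p) z = ?e * packet \<gamma> (of_real \<sigma> * ?q) z" by simp
  then show "\<i> * ?wt z = of_real \<sigma> * bf_proj (\<lambda>w. of_real ((cmod (wave l' c d \<gamma>0 \<delta> t w))\<^sup>2) * wave l a b \<gamma>0 \<delta> t w) z"
    unfolding R \<zeta>_def[symmetric] packet_mult[symmetric] by (simp only: mult.left_commute)
qed

lemma wave_fock_flow:
  assumes ab: "cnj a * b = - 8 * \<i> * \<delta>" and cd: "cnj c * d = 8 * \<i> * \<delta>"
    and A: "a * cnj a = of_real A" "b * cnj b = 3 * of_real A" "c * cnj c = of_real A" "d * cnj d = 3 * of_real A"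
    and l: "l = Im (cnj \<gamma>0 * \<delta>) + 7 / 8 * A" "l' = Im (cnj \<gamma>0 * \<delta>) - 7 / 8 * A"
  shows "fock_flow (wave l a b \<gamma>0 \<delta>) (wave l' c d \<gamma>0 \<delta>)"
  unfolding fock_flow_def
proof (intro allI conjI wave_in_bargmann_fock)
  fix t
  obtain ut where ut: "ut \<in> bargmann_fock" "has_L2_derivative (wave l a b \<gamma>0 \<delta>) ut t"
    "\<And>z. \<i> * ut z = of_real 1 * bf_proj (\<lambda>w. of_real ((cmod (wave l' c d \<gamma>0 \<delta> t w))\<^sup>2) * wave l a b \<gamma>0 \<delta> t w) z"
    by (rule wave_equation[of 1 l \<gamma>0 \<delta> A a b c d t l']) (use assms in auto)
  obtain vt where vt: "vt \<in> bargmann_fock" "has_L2_derivative (wave l' c d \<gamma>0 \<delta>) vt t"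
    "\<And>z. \<i> * vt z = of_real (-1) * bf_proj (\<lambda>w. of_real ((cmod (wave l a b \<gamma>0 \<delta> t w))\<^sup>2) * wave l' c d \<gamma>0 \<delta> t w) z"
    by (rule wave_equation[of "-1" l' \<gamma>0 \<delta> A c d a b t l]) (use assms in auto)
  show "\<exists>ut\<in>bargmann_fock. \<exists>vt\<in>bargmann_fock.
        has_L2_derivative (wave l a b \<gamma>0 \<delta>) ut t \<and> has_L2_derivative (wave l' c d \<gamma>0 \<delta>) vt t \<and>
        (\<forall>z. \<i> * ut z = bf_proj (\<lambda>w. of_real ((cmod (wave l' c d \<gamma>0 \<delta> t w))\<^sup>2) * wave l a b \<gamma>0 \<delta> t w) z) \<and>
        (\<forall>z. \<i> * vt z = - bf_proj (\<lambda>w. of_real ((cmod (wave l a b \<gamma>0 \<delta> t w))\<^sup>2) * wave l' c d \<gamma>0 \<delta> t w) z)"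
    using ut vt by (intro bexI[of _ ut] bexI[of _ vt]) auto
qed

section \<open>Growth of the weighted norms\<close>

lemma wave_profile:
  "(cmod (wave l a b \<gamma>0 \<delta> t (cnj (\<gamma>0 + of_real t * \<delta>) + w)))\<^sup>2 = (cmod (a + b * w))\<^sup>2 * exp (- (cmod w)\<^sup>2)"
proof -
  define \<gamma> where "\<gamma> = \<gamma>0 + of_real t * \<delta>"
  have ph: "cmod (exp (- \<i> * of_real l * of_real t)) = 1"
    using norm_exp_i_times[of "- l * t"] by (simp add: mult.assoc)
  have "(cmod (cnj \<gamma> + w))\<^sup>2 + (cmod \<gamma>)\<^sup>2 - 2 * Re (\<gamma> * (cnj \<gamma> + w)) = (cmod w)\<^sup>2"
    unfolding cmod_power2 by (simp add: power2_eq_square algebra_simps)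
  then have ex: "2 * Re (- of_real ((cmod (cnj \<gamma> + w))\<^sup>2 / 2) - of_real ((cmod \<gamma>)\<^sup>2 / 2) + \<gamma> * (cnj \<gamma> + w)) = - (cmod w)\<^sup>2"
    unfolding plus_complex.sel(1) minus_complex.sel(1) uminus_complex.sel(1) Re_complex_of_real by (simp add: field_simps)
  show ?thesis
    unfolding wave_def \<gamma>_def[symmetric] packet_def norm_mult ph norm_exp_eq_Re power_mult_distrib exp_double[symmetric] ex
    by simp
qed

lemma measurable_wave [measurable]: "wave l a b \<gamma>0 \<delta> t \<in> borel_measurable borel"
  unfolding wave_def[abs_def] packet_def by measurable

lemma japanese_bracket_pos: "0 < japanese_bracket z"
  by (simp add: japanese_bracket_def add_pos_nonneg)

lemma japanese_bracket_le: "japanese_bracket z \<le> 1 + cmod z"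
  unfolding japanese_bracket_def by (intro real_le_lsqrt) (auto simp: power2_sum)

lemma measurable_japanese_bracket [measurable]: "japanese_bracket \<in> borel_measurable borel"
  unfolding japanese_bracket_def[abs_def] by measurable

lemma weighted_norm_wave:
  "weighted_norm s (wave l a b \<gamma>0 \<delta> t)
   = sqrt (\<integral>w. (japanese_bracket (cnj (\<gamma>0 + of_real t * \<delta>) + w) powr s)\<^sup>2 * ((cmod (a + b * w))\<^sup>2 * exp (- (cmod w)\<^sup>2)) \<partial>lborel)"
proof -
  let ?c = "cnj (\<gamma>0 + of_real t * \<delta>)"
  have "(\<integral>z. (cmod (of_real (japanese_bracket z powr s) * wave l a b \<gamma>0 \<delta> t z))\<^sup>2 \<partial>lborel)
      = (\<integral>w. (cmod (of_real (japanese_bracket (?c + w) powr s) * wave l a b \<gamma>0 \<delta> t (?c + w)))\<^sup>2 \<partial>lborel)"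
    by (rule integral_translate[symmetric]) measurable
  then show ?thesis
    unfolding weighted_norm_def L2_norm_def norm_mult power_mult_distrib wave_profile by simp
qed

lemma linear_profile_bound:
  "(cmod (a + b * w))\<^sup>2 * exp (- (cmod w)\<^sup>2) \<le> (cmod a + cmod b)\<^sup>2 * exp (2 * cmod w - 1 * (cmod w)\<^sup>2)"
proof -
  have "cmod (a + b * w) \<le> (cmod a + cmod b) * exp (cmod w)"
    using quadratic_le_exp[of a b w 0] by simp
  then have "(cmod (a + b * w))\<^sup>2 \<le> ((cmod a + cmod b) * exp (cmod w))\<^sup>2"
    by (intro power_mono) auto
  then have "(cmod (a + b * w))\<^sup>2 * exp (- (cmod w)\<^sup>2) \<le> ((cmod a + cmod b) * exp (cmod w))\<^sup>2 * exp (- (cmod w)\<^sup>2)"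
    by (intro mult_right_mono) auto
  moreover have "(exp (cmod w))\<^sup>2 * exp (- (cmod w)\<^sup>2) = exp (2 * cmod w - 1 * (cmod w)\<^sup>2)"
    by (simp add: exp_diff exp_minus divide_inverse flip: exp_double)
  then have "((cmod a + cmod b) * exp (cmod w))\<^sup>2 * exp (- (cmod w)\<^sup>2)
      = (cmod a + cmod b)\<^sup>2 * exp (2 * cmod w - 1 * (cmod w)\<^sup>2)"
    by (simp only: power_mult_distrib mult.assoc)
  ultimately show ?thesis by simp
qed

text \<open>
  Averaging over \<open>w\<close> and \<open>-w\<close> removes the mixed term by the parallelogram law.
\<close>

lemma linear_profile_mass:
  "(\<integral>w. (cmod (a + b * w))\<^sup>2 * exp (- (cmod w)\<^sup>2) \<partial>lborel) = pi * ((cmod a)\<^sup>2 + (cmod b)\<^sup>2)"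
proof -
  let ?g = "\<lambda>w. (cmod (a + b * w))\<^sup>2 * exp (- (cmod w)\<^sup>2)"
  have gi: "integrable lborel (\<lambda>w. (cmod (a + b * w))\<^sup>2 * exp (- (cmod w)\<^sup>2))" for a b
    by (rule integrable_gaussian_bound[of 1 _ "(cmod a + cmod b)\<^sup>2" 2]) (use linear_profile_bound[of a b] in auto)
  have "integral\<^sup>L lborel ?g = (\<integral>w. ?g (- 1 * w) \<partial>lborel)"
    by (rule integral_rotate[symmetric]) auto
  then have "2 * integral\<^sup>L lborel ?g = integral\<^sup>L lborel ?g + (\<integral>w. (cmod (a + (- b) * w))\<^sup>2 * exp (- (cmod w)\<^sup>2) \<partial>lborel)"
    by simp
  also have "\<dots> = (\<integral>w. ?g w + (cmod (a + (- b) * w))\<^sup>2 * exp (- (cmod w)\<^sup>2) \<partial>lborel)"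
    by (rule Bochner_Integration.integral_add[symmetric]) (rule gi)+
  also have "\<dots> = (\<integral>w. 2 * (cmod a)\<^sup>2 * ((cmod w)\<^sup>2 ^ 0 * exp (- 1 * (cmod w)\<^sup>2))
       + 2 * (cmod b)\<^sup>2 * ((cmod w)\<^sup>2 ^ 1 * exp (- 1 * (cmod w)\<^sup>2)) \<partial>lborel)"
  proof (intro Bochner_Integration.integral_cong refl)
    fix w
    have "(cmod (a + b * w))\<^sup>2 + (cmod (a + (- b) * w))\<^sup>2 = 2 * (cmod a)\<^sup>2 + 2 * (cmod b)\<^sup>2 * (cmod w)\<^sup>2"
    proof -
      have "(cmod (a + b * w))\<^sup>2 + (cmod (a - b * w))\<^sup>2 = 2 * (cmod a)\<^sup>2 + 2 * (cmod (b * w))\<^sup>2"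
        unfolding cmod_power2 plus_complex.sel minus_complex.sel by (simp add: power2_eq_square algebra_simps)
      then show ?thesis by (simp add: norm_mult power_mult_distrib)
    qed
    from arg_cong[OF this, of "\<lambda>x. x * exp (- (cmod w)\<^sup>2)"]
    show "?g w + (cmod (a + (- b) * w))\<^sup>2 * exp (- (cmod w)\<^sup>2)
       = 2 * (cmod a)\<^sup>2 * ((cmod w)\<^sup>2 ^ 0 * exp (- 1 * (cmod w)\<^sup>2))
       + 2 * (cmod b)\<^sup>2 * ((cmod w)\<^sup>2 ^ 1 * exp (- 1 * (cmod w)\<^sup>2))"
      by (simp add: algebra_simps)
  qed
  also have "\<dots> = 2 * (cmod a)\<^sup>2 * (pi * fact 0 / 1 ^ Suc 0) + 2 * (cmod b)\<^sup>2 * (pi * fact 1 / 1 ^ Suc 1)"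
    by (intro has_bochner_integral_integral_eq has_bochner_integral_add has_bochner_integral_mult_right
        has_bochner_integral_gaussian_moment) auto
  finally show ?thesis by (simp add: algebra_simps)
qed

lemma powr_le_exp:
  fixes x s :: real
  assumes "0 < x" "x \<le> y" "0 \<le> s"
  shows "x powr s \<le> exp (s * y)"
proof -
  have "ln x \<le> y" using ln_le_minus_one[OF assms(1)] assms(2) by linarith
  then show ?thesis using assms by (simp add: powr_def mult_left_mono)
qed

text \<open>
  The quotient \<open>J t w\<close> of the weight at \<open>w\<close> relative to the moving centre by \<open>t\<close> tends to the speed, and for
  \<open>t \<ge> 1\<close> it is at most \<open>D + |w|\<close>; its powers thus grow at most exponentially in \<open>|w|\<close>, and dominated
  convergence applies.
\<close>

lemma weighted_norm_wave_limit:
  assumes s: "s \<ge> 0" and \<delta>: "\<delta> \<noteq> 0"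
  shows "((\<lambda>t. weighted_norm s (wave l a b \<gamma>0 \<delta> t) / t powr s)
          \<longlongrightarrow> cmod \<delta> powr s * sqrt (pi * ((cmod a)\<^sup>2 + (cmod b)\<^sup>2))) at_top"
proof -
  define J where "J t w = japanese_bracket (cnj (\<gamma>0 + of_real t * \<delta>) + w) / t" for t :: real and w
  define g where "g w = (cmod (a + b * w))\<^sup>2 * exp (- (cmod w)\<^sup>2)" for w
  define D where "D = 1 + cmod \<gamma>0 + cmod \<delta>"
  have gm: "g \<in> borel_measurable borel" unfolding g_def by measurable
  have Jm: "J t \<in> borel_measurable borel" for t unfolding J_def by measurable
  have Jpos: "0 < J t w" if "t \<ge> 1" for t w
    using that japanese_bracket_pos by (simp add: J_def)
  have Jle: "J t w \<le> D + cmod w" if t: "t \<ge> 1" for t w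
  proof -
    have "cmod (cnj (\<gamma>0 + of_real t * \<delta>) + w) \<le> cmod \<gamma>0 + t * cmod \<delta> + cmod w"
      using t by (intro norm_triangle_le add_mono) (auto simp: norm_mult intro!: norm_triangle_le)
    then have "japanese_bracket (cnj (\<gamma>0 + of_real t * \<delta>) + w) \<le> 1 * 1 + 1 * cmod \<gamma>0 + t * cmod \<delta> + 1 * cmod w"
      using japanese_bracket_le[of "cnj (\<gamma>0 + of_real t * \<delta>) + w"] by linarith
    also have "\<dots> \<le> t * 1 + t * cmod \<gamma>0 + t * cmod \<delta> + t * cmod w"
      using t by (intro add_mono mult_right_mono) auto
    finally show ?thesis using t by (simp add: J_def D_def divide_le_eq algebra_simps)
  qed
  have Jlim: "((\<lambda>t. J t w) \<longlongrightarrow> cmod \<delta>) at_top" for w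
  proof -
    have i: "((\<lambda>t::real. inverse t) \<longlongrightarrow> 0) at_top" by (rule tendsto_inverse_0_at_top) (rule filterlim_ident)
    then have ic: "((\<lambda>t::real. complex_of_real (inverse t)) \<longlongrightarrow> 0) at_top"
      using tendsto_of_real[OF i, where 'a = complex] by simp
    have "((\<lambda>t. sqrt ((inverse t)\<^sup>2 + (cmod (complex_of_real (inverse t) * (cnj \<gamma>0 + w) + cnj \<delta>))\<^sup>2))
       \<longlongrightarrow> sqrt (0\<^sup>2 + (cmod (0 * (cnj \<gamma>0 + w) + cnj \<delta>))\<^sup>2)) at_top"
      by (intro tendsto_intros i ic)
    moreover have "\<forall>\<^sub>F t in at_top. sqrt ((inverse t)\<^sup>2 + (cmod (complex_of_real (inverse t) * (cnj \<gamma>0 + w) + cnj \<delta>))\<^sup>2) = J t w"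
    proof (rule eventually_at_top_linorderI[of 1])
      fix t :: real assume t: "1 \<le> t"
      have eq: "complex_of_real (inverse t) * (cnj \<gamma>0 + w) + cnj \<delta> = (cnj (\<gamma>0 + of_real t * \<delta>) + w) / of_real t"
        using t by (simp add: field_simps)
      have "(inverse t)\<^sup>2 + (cmod (complex_of_real (inverse t) * (cnj \<gamma>0 + w) + cnj \<delta>))\<^sup>2
          = (1 + (cmod (cnj (\<gamma>0 + of_real t * \<delta>) + w))\<^sup>2) / t\<^sup>2"
        unfolding eq norm_divide using t by (simp add: power_divide inverse_eq_divide add_divide_distrib)
      then show "sqrt ((inverse t)\<^sup>2 + (cmod (complex_of_real (inverse t) * (cnj \<gamma>0 + w) + cnj \<delta>))\<^sup>2) = J t w"
        using t by (simp add: J_def japanese_bracket_def real_sqrt_divide)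
    qed
    ultimately show ?thesis by (simp add: Lim_transform_eventually)
  qed
  have "((\<lambda>t. \<integral>w. (J t w powr s)\<^sup>2 * g w \<partial>lborel) \<longlongrightarrow> (\<integral>w. (cmod \<delta> powr s)\<^sup>2 * g w \<partial>lborel)) at_top"
  proof (rule integral_dominated_convergence_at_top)
    let ?b = "\<lambda>w. ((cmod a + cmod b)\<^sup>2 * exp (2 * s * D)) * exp ((2 * s + 2) * cmod w - 1 * (cmod w)\<^sup>2)"
    show "integrable lborel ?b"
      by (rule integrable_gaussian_bound[of 1 _ "(cmod a + cmod b)\<^sup>2 * exp (2 * s * D)" "2 * s + 2"]) auto
    show "(\<lambda>w. (J t w powr s)\<^sup>2 * g w) \<in> borel_measurable lborel" for t using gm Jm[of t] by simp
    show "(\<lambda>w. (cmod \<delta> powr s)\<^sup>2 * g w) \<in> borel_measurable lborel" using gm by simp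
    show "AE w in lborel. ((\<lambda>t. (J t w powr s)\<^sup>2 * g w) \<longlongrightarrow> (cmod \<delta> powr s)\<^sup>2 * g w) at_top"
      using \<delta> by (intro AE_I2 tendsto_intros Jlim) auto
    show "\<forall>\<^sub>F t in at_top. AE w in lborel. norm ((J t w powr s)\<^sup>2 * g w) \<le> ?b w"
    proof (intro eventually_at_top_linorderI[of 1] AE_I2)
      fix t :: real and w assume t: "1 \<le> t"
      have "J t w powr s \<le> exp (s * (D + cmod w))"
        using Jpos Jle t s by (intro powr_le_exp) auto
      then have "(J t w powr s)\<^sup>2 \<le> (exp (s * (D + cmod w)))\<^sup>2"
        by (intro power_mono) auto
      then have "(J t w powr s)\<^sup>2 * g w \<le> (exp (s * (D + cmod w)))\<^sup>2 * ((cmod a + cmod b)\<^sup>2 * exp (2 * cmod w - 1 * (cmod w)\<^sup>2))"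
        unfolding g_def by (intro mult_mono linear_profile_bound) auto
      also have "\<dots> = (cmod a + cmod b)\<^sup>2 * exp (2 * (s * (D + cmod w)) + (2 * cmod w - 1 * (cmod w)\<^sup>2))"
        unfolding exp_double[symmetric] exp_add by simp
      also have "2 * (s * (D + cmod w)) + (2 * cmod w - 1 * (cmod w)\<^sup>2) = 2 * s * D + ((2 * s + 2) * cmod w - 1 * (cmod w)\<^sup>2)"
        by (simp add: algebra_simps)
      finally show "norm ((J t w powr s)\<^sup>2 * g w) \<le> ?b w"
        unfolding exp_add by (simp add: g_def mult.assoc)
    qed
  qed
  also have "(\<integral>w. (cmod \<delta> powr s)\<^sup>2 * g w \<partial>lborel) = (cmod \<delta> powr s)\<^sup>2 * (pi * ((cmod a)\<^sup>2 + (cmod b)\<^sup>2))"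
    unfolding g_def by (simp add: linear_profile_mass)
  finally have "((\<lambda>t. sqrt (\<integral>w. (J t w powr s)\<^sup>2 * g w \<partial>lborel)) \<longlongrightarrow> sqrt ((cmod \<delta> powr s)\<^sup>2 * (pi * ((cmod a)\<^sup>2 + (cmod b)\<^sup>2)))) at_top"
    by (rule tendsto_real_sqrt)
  moreover have "\<forall>\<^sub>F t in at_top. sqrt (\<integral>w. (J t w powr s)\<^sup>2 * g w \<partial>lborel) = weighted_norm s (wave l a b \<gamma>0 \<delta> t) / t powr s"
  proof (rule eventually_at_top_linorderI[of 1])
    fix t :: real assume t: "1 \<le> t"
    have "(\<integral>w. (J t w powr s)\<^sup>2 * g w \<partial>lborel)
        = (\<integral>w. (japanese_bracket (cnj (\<gamma>0 + of_real t * \<delta>) + w) powr s)\<^sup>2 * g w / (t powr s)\<^sup>2 \<partial>lborel)"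
      using t japanese_bracket_pos by (simp add: J_def powr_divide less_imp_le power_divide)
    also have "\<dots> = (\<integral>w. (japanese_bracket (cnj (\<gamma>0 + of_real t * \<delta>) + w) powr s)\<^sup>2 * g w \<partial>lborel) / (t powr s)\<^sup>2"
      by simp
    finally show "sqrt (\<integral>w. (J t w powr s)\<^sup>2 * g w \<partial>lborel) = weighted_norm s (wave l a b \<gamma>0 \<delta> t) / t powr s"
      unfolding weighted_norm_wave g_def by (simp add: real_sqrt_divide)
  qed
  ultimately show ?thesis by (simp add: Lim_transform_eventually real_sqrt_mult)
qed

text \<open>
  Reversing time turns a wave into the wave with opposite velocity and frequency, so the limit at
  \<open>-\<infinity>\<close> follows from the one at \<open>+\<infinity>\<close>.
\<close>

lemma weighted_norm_wave_asymp:
  assumes s: "s \<ge> 0" and K: "K > 0" and \<alpha>: "\<alpha> > 0"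
    and speed: "cmod \<delta> = \<alpha> * K\<^sup>2" and mass: "pi * ((cmod a)\<^sup>2 + (cmod b)\<^sup>2) = K\<^sup>2"
  shows "(\<lambda>t. weighted_norm s (wave l a b \<gamma>0 \<delta> t)) \<sim>[at_top] (\<lambda>t. \<alpha> powr s * K powr (2 * s + 1) * \<bar>t\<bar> powr s)" (is ?top)
    and "(\<lambda>t. weighted_norm s (wave l a b \<gamma>0 \<delta> t)) \<sim>[at_bot] (\<lambda>t. \<alpha> powr s * K powr (2 * s + 1) * \<bar>t\<bar> powr s)" (is ?bot)
proof -
  let ?c = "\<alpha> powr s * K powr (2 * s + 1)"
  have c0: "?c \<noteq> 0" using \<alpha> K by simp
  have lim: "((\<lambda>t. weighted_norm s (wave l' a b \<gamma>0 \<delta>' t) / (?c * \<bar>t\<bar> powr s)) \<longlongrightarrow> 1) at_top"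
    if "cmod \<delta>' = \<alpha> * K\<^sup>2" for \<delta>' l'
  proof -
    have "K\<^sup>2 powr s = K powr (2 * s)" using K by (simp add: powr_powr flip: powr_numeral)
    then have c: "cmod \<delta>' powr s * sqrt (pi * ((cmod a)\<^sup>2 + (cmod b)\<^sup>2)) = ?c"
      using K \<alpha> by (simp add: that mass powr_mult powr_add)
    have "\<delta>' \<noteq> 0" using that K \<alpha> by auto
    then have "((\<lambda>t. weighted_norm s (wave l' a b \<gamma>0 \<delta>' t) / t powr s / ?c) \<longlongrightarrow> ?c / ?c) at_top"
      unfolding c[symmetric] by (intro tendsto_divide tendsto_const weighted_norm_wave_limit s) (use c c0 in auto)
    then have "((\<lambda>t. weighted_norm s (wave l' a b \<gamma>0 \<delta>' t) / t powr s / ?c) \<longlongrightarrow> 1) at_top"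
      using c0 by simp
    then show ?thesis
      by (rule Lim_transform_eventually) (auto intro!: eventually_at_top_linorderI[of 0] simp: mult.commute)
  qed
  show ?top by (rule asymp_equivI', rule lim, rule speed)
  have rev: "wave l a b \<gamma>0 \<delta> (- t) = wave (- l) a b \<gamma>0 (- \<delta>) t" for t
    by (simp add: wave_def fun_eq_iff)
  show ?bot
  proof (rule asymp_equivI')
    show "((\<lambda>t. weighted_norm s (wave l a b \<gamma>0 \<delta> t) / (?c * \<bar>t\<bar> powr s)) \<longlongrightarrow> 1) at_bot"
      unfolding filterlim_at_bot_mirror rev using lim[of "- \<delta>" "- l"] speed by simp
  qed
qed

theorem corollary1p7:
  fixes K \<theta> \<theta>1 \<theta>2 \<alpha>0 :: real and \<gamma> :: complex
    and U V :: "complex \<Rightarrow> complex"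
    and u v :: "real \<Rightarrow> complex \<Rightarrow> complex"
  assumes K: "K > 0"
    and U: "U = (\<lambda>z. of_real K * exp (\<i> * of_real \<theta>1) *
              (1 / 2 * phi 0 \<gamma> z + of_real (sqrt 3 / 2) * \<i> * exp (\<i> * of_real \<theta>) * phi 1 \<gamma> z))"
    and V: "V = (\<lambda>z. of_real K * exp (\<i> * of_real \<theta>2) *
              (1 / 2 * phi 0 \<gamma> z - of_real (sqrt 3 / 2) * \<i> * exp (\<i> * of_real \<theta>) * phi 1 \<gamma> z))"
    and sol: "is_solution u v U V"
    and \<alpha>0: "\<alpha>0 = sqrt 3 / (32 * pi)"
  shows "\<forall>s\<ge>0.
     (\<lambda>t. weighted_norm s (u t)) \<sim>[at_top] (\<lambda>t. \<alpha>0 powr s * K powr (2 * s + 1) * \<bar>t\<bar> powr s) \<and>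
     (\<lambda>t. weighted_norm s (u t)) \<sim>[at_bot] (\<lambda>t. \<alpha>0 powr s * K powr (2 * s + 1) * \<bar>t\<bar> powr s) \<and>
     (\<lambda>t. weighted_norm s (v t)) \<sim>[at_top] (\<lambda>t. \<alpha>0 powr s * K powr (2 * s + 1) * \<bar>t\<bar> powr s) \<and>
     (\<lambda>t. weighted_norm s (v t)) \<sim>[at_bot] (\<lambda>t. \<alpha>0 powr s * K powr (2 * s + 1) * \<bar>t\<bar> powr s)"
proof -
  \<comment> \<open>\<open>A\<close> is the common value of \<open>|a|\<^sup>2\<close> and \<open>|c|\<^sup>2\<close>; the normalization of \<^term>\<open>phi\<close> puts
    \<open>\<surd>\<pi>\<close> into \<open>r\<close>\<close>
  define A where "A = K\<^sup>2 / (4 * pi)"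
  define r where "r = K / (2 * sqrt pi)"
  define e where "e = exp (\<i> * of_real \<theta>)"
  define a where "a = of_real r * exp (\<i> * of_real \<theta>1)"
  define b where "b = of_real (sqrt 3) * \<i> * e * a"
  define c where "c = of_real r * exp (\<i> * of_real \<theta>2)"
  define d where "d = - of_real (sqrt 3) * \<i> * e * c"
  define \<delta> where "\<delta> = - of_real (\<alpha>0 * K\<^sup>2) * e"
  have unit: "exp (\<i> * of_real x) * cnj (exp (\<i> * of_real x)) = 1" for x
    by (simp add: complex_norm_square[symmetric])
  have rr: "of_real r * of_real r = (of_real A :: complex)"
    by (simp add: r_def A_def power2_eq_square flip: of_real_mult)
  have s3: "of_real (sqrt 3) * of_real (sqrt 3) = (3 :: complex)"
    by (simp flip: of_real_mult)
  have aa: "a * cnj a = of_real A"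
  proof -
    have "a * cnj a = (of_real r * of_real r) * (exp (\<i> * of_real \<theta>1) * cnj (exp (\<i> * of_real \<theta>1)))"
      by (simp add: a_def)
    then show ?thesis unfolding rr unit by simp
  qed
  have cc: "c * cnj c = of_real A"
  proof -
    have "c * cnj c = (of_real r * of_real r) * (exp (\<i> * of_real \<theta>2) * cnj (exp (\<i> * of_real \<theta>2)))"
      by (simp add: c_def)
    then show ?thesis unfolding rr unit by simp
  qed
  have ee: "e * cnj e = 1" unfolding e_def by (rule unit)
  have bb: "b * cnj b = 3 * of_real A"
  proof -
    have "b * cnj b = - (\<i> * \<i>) * (of_real (sqrt 3) * of_real (sqrt 3)) * (e * cnj e) * (a * cnj a)"
      unfolding b_def complex_cnj_mult complex_cnj_minus complex_cnj_complex_of_real complex_cnj_i by algebra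
    then show ?thesis unfolding s3 ee aa by simp
  qed
  have dd: "d * cnj d = 3 * of_real A"
  proof -
    have "d * cnj d = - (\<i> * \<i>) * (of_real (sqrt 3) * of_real (sqrt 3)) * (e * cnj e) * (c * cnj c)"
      unfolding d_def complex_cnj_mult complex_cnj_minus complex_cnj_complex_of_real complex_cnj_i by algebra
    then show ?thesis unfolding s3 ee cc by simp
  qed
  have s3A: "of_real (sqrt 3) * of_real A = (8 * of_real (\<alpha>0 * K\<^sup>2) :: complex)"
  proof -
    have "sqrt 3 * A = 8 * (\<alpha>0 * K\<^sup>2)" by (simp add: A_def \<alpha>0 field_simps)
    from arg_cong[OF this, of complex_of_real] show ?thesis by simp
  qed
  have ab: "cnj a * b = - 8 * \<i> * \<delta>"
  proof -
    have "cnj a * b = (of_real (sqrt 3) * (a * cnj a)) * \<i> * e" by (simp add: b_def)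
    then show ?thesis unfolding aa s3A by (simp add: \<delta>_def)
  qed
  have cd: "cnj c * d = 8 * \<i> * \<delta>"
  proof -
    have "cnj c * d = - (of_real (sqrt 3) * (c * cnj c)) * \<i> * e" by (simp add: d_def)
    then show ?thesis unfolding cc s3A by (simp add: \<delta>_def)
  qed
  define l where "l = Im (cnj \<gamma> * \<delta>) + 7 / 8 * A"
  define l' where "l' = Im (cnj \<gamma> * \<delta>) - 7 / 8 * A"
  have flow: "fock_flow (wave l a b \<gamma> \<delta>) (wave l' c d \<gamma> \<delta>)"
    by (rule wave_fock_flow[OF ab cd aa bb cc dd l_def l'_def])
  have U0: "wave l a b \<gamma> \<delta> 0 = U"
    unfolding U wave_def packet_def phi_def b_def a_def r_def e_def
    by (simp add: fun_eq_iff field_simps)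
  have V0: "wave l' c d \<gamma> \<delta> 0 = V"
    unfolding V wave_def packet_def phi_def d_def c_def r_def e_def
    by (simp add: fun_eq_iff field_simps)
  have sol0: "u 0 = U" "v 0 = V" using sol by (simp_all add: is_solution_def)
  have uv: "u t = wave l a b \<gamma> \<delta> t" "v t = wave l' c d \<gamma> \<delta> t" for t
    using fock_flow_unique[OF is_solution_imp_fock_flow[OF sol] flow, of t] U0 V0 sol0 by auto
  have \<alpha>pos: "\<alpha>0 > 0" by (simp add: \<alpha>0)
  have speed: "cmod \<delta> = \<alpha>0 * K\<^sup>2"
    using \<alpha>pos by (simp add: \<delta>_def e_def norm_mult norm_power)
  have sq: "(cmod x)\<^sup>2 = y" if "x * cnj x = of_real y" for x y
    using that by (simp only: complex_norm_square[symmetric] of_real_eq_iff flip: of_real_power)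
  have "(cmod a)\<^sup>2 = A" "(cmod b)\<^sup>2 = 3 * A" "(cmod c)\<^sup>2 = A" "(cmod d)\<^sup>2 = 3 * A"
    using aa bb cc dd by (auto intro!: sq)
  then have mass: "pi * ((cmod a)\<^sup>2 + (cmod b)\<^sup>2) = K\<^sup>2" "pi * ((cmod c)\<^sup>2 + (cmod d)\<^sup>2) = K\<^sup>2"
    by (simp_all add: A_def)
  show ?thesis
    unfolding uv using weighted_norm_wave_asymp[OF _ K \<alpha>pos speed] mass by blast
qed

end
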